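(* Let $\tau\in\mathbb{H}$. For any positive integer $k$ and $z\in\mathbb{C}\setminus L_\tau$, we have $$\wp_2^{(2k-2)}(z)=k\,(2k-1)!\,\operatorname{Tr}_k\bigl(\phi_{\log};\wp_2(z),-\wp_{2,2}(z),\wp_{2,2,2}(z),\dots,(-1)^{k+1}\wp_{\{2\}^k}(z)\bigr)$$ and $$\wp_2^{(2k-2)}(z)=(2k-1)!\Bigl(G_{2k}+k\cdot\operatorname{Tr}_k\bigl(\phi_{\log};\wp(z),-3G_4,-5G_6,\dots,-(2k-1)G_{2k}\bigr)\Bigr).$$
   Context: $\mathbb{H}$ is the upper half-plane, $L_\tau=\mathbb{Z}\tau+\mathbb{Z}$, $\mathbb{Z}_N=\{n\in\mathbb{Z}: |n|<N\}$, and $\mathbb{Z}_M\tau+\mathbb{Z}_N=\{m\tau+n: m\in\mathbb{Z}_M, n\in\mathbb{Z}_N\}$. The order $\prec$ on $L_\tau$: $m_1\tau+n_1\prec m_2\tau+n_2$ iff $m_1<m_2$, or $m_1=m_2$ and $n_1<n_2$. For integers $k_1,\dots,k_r\ge2$, $$\wp_{k_1,\dots,k_r}(z)=\wp_{k_1,\dots,k_r}(z;\tau)=\lim_{M\to\infty}\lim_{N\to\infty}\sum_{\substack{w_1,\dots,w_r\in\mathbb{Z}_M\tau+\mathbb{Z}_N\\ w_1\prec\dots\prec w_r}}\frac{1}{(z-w_1)^{k_1}\cdots(z-w_r)^{k_r}},$$ $\{2\}^r$ is the index $(2,\dots,2)$ with $r$ entries, and $\wp_2^{(m)}$ is the $m$-th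 derivative of $\wp_2$ in $z$. $\wp(z)=\frac1{z^2}+\sum_{w\in L_\tau\setminus\{0\}}\left(\frac1{(z-w)^2}-\frac1{w^2}\right)$ is the Weierstrass function of $L_\tau$. For $k\ge2$, $G_k=G_k(\tau)=\lim_{M\to\infty}\lim_{N\to\infty}\sum_{(m,n)\in\mathbb{Z}_M\times\mathbb{Z}_N\setminus\{(0,0)\}}(m\tau+n)^{-k}$. A partition $\lambda\vdash n$ is written $\lambda=(1^{m_1},\dots,n^{m_n})$, where $m_k$ is the multiplicity of $k$; $\ell(\lambda)=m_1+\cdots+m_n$. For a function $\phi$ on partitions, $\operatorname{Tr}_n(\phi;X_1,\dots,X_n)=\sum_{\lambda\vdash n}\phi(\lambda)\prod_{j=1}^nX_j^{m_j}$. Here $\phi_{\log}(\lambda)=(\ell(\lambda)-1)!\prod_{k=1}^n\frac1{m_k!}$. (In the second formula the arguments are $X_1=\wp(z)$ and $X_j=-(2j-1)G_{2j}$ for $2\le j\le k$.) *)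

theory Defs
  imports "HOL-Complex_Analysis.Complex_Analysis" "HOL-Library.Multiset"
begin

definition period_lattice :: "complex \<Rightarrow> complex set" where
  "period_lattice \<tau> = {of_int m * \<tau> + of_int n | m n :: int. True}"

definition int_box :: "nat \<Rightarrow> int set" where
  "int_box N = {n. \<bar>n\<bar> < int N}"

definition lattice_box :: "complex \<Rightarrow> nat \<Rightarrow> nat \<Rightarrow> complex set" where
  "lattice_box \<tau> M N = {of_int m * \<tau> + of_int n | m n. m \<in> int_box M \<and> n \<in> int_box N}"

text \<open>For non-real \<open>\<tau>\<close> the coordinates of a lattice point are unique, so this is a strict
  linear order on \<open>period_lattice \<tau>\<close>.\<close>

definition lattice_less :: "complex \<Rightarrow> complex \<Rightarrow> complex \<Rightarrow> bool" where
  "lattice_less \<tau> w w' \<longleftrightarrow>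
     (\<exists>m n m' n' :: int. w = of_int m * \<tau> + of_int n \<and> w' = of_int m' * \<tau> + of_int n' \<and>
        (m < m' \<or> m = m' \<and> n < n'))"

definition increasing_tuples :: "complex \<Rightarrow> nat \<Rightarrow> nat \<Rightarrow> nat \<Rightarrow> complex list set" where
  "increasing_tuples \<tau> r M N =
     {ws. length ws = r \<and> set ws \<subseteq> lattice_box \<tau> M N \<and> sorted_wrt (lattice_less \<tau>) ws}"

definition multi_wp :: "nat list \<Rightarrow> complex \<Rightarrow> complex \<Rightarrow> complex" where
  "multi_wp ks \<tau> z =
     lim (\<lambda>M. lim (\<lambda>N. \<Sum>ws\<in>increasing_tuples \<tau> (length ks) M N.
                        1 / (\<Prod>i<length ks. (z - ws ! i) ^ (ks ! i))))"

definition weierstrass_wp :: "complex \<Rightarrow> complex \<Rightarrow> complex" where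
  "weierstrass_wp \<tau> z =
     1 / z\<^sup>2 + (\<Sum>\<^sub>\<infinity>w\<in>period_lattice \<tau> - {0}. 1 / (z - w)\<^sup>2 - 1 / w\<^sup>2)"

definition eisenstein_G :: "nat \<Rightarrow> complex \<Rightarrow> complex" where
  "eisenstein_G k \<tau> =
     lim (\<lambda>M. lim (\<lambda>N. \<Sum>(m, n)\<in>int_box M \<times> int_box N - {(0, 0)}.
                        1 / (of_int m * \<tau> + of_int n) ^ k))"

text \<open>A partition is the multiset of its parts: the multiplicity of \<open>k\<close> is \<open>count p k\<close>, and the
  length is \<open>size p\<close>.\<close>

definition int_partitions :: "nat \<Rightarrow> nat multiset set" where
  "int_partitions n = {p. 0 \<notin># p \<and> \<Sum>\<^sub># p = n}"

definition partition_trace ::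
    "nat \<Rightarrow> (nat multiset \<Rightarrow> complex) \<Rightarrow> (nat \<Rightarrow> complex) \<Rightarrow> complex" where
  "partition_trace n \<phi> X = (\<Sum>p\<in>int_partitions n. \<phi> p * (\<Prod>j=1..n. X j ^ count p j))"

definition phi_log :: "nat multiset \<Rightarrow> complex" where
  "phi_log p = fact (size p - 1) * (\<Prod>k=1..\<Sum>\<^sub># p. 1 / fact (count p k))"

text \<open>The index sets of the finite sums above are indeed finite, so none of these sums collapses
  to the default value \<open>0\<close>.\<close>

lemma finite_int_box: "finite (int_box N)"
  by (rule finite_subset[of _ "{- int N..int N}"]) (auto simp: int_box_def)

lemma finite_increasing_tuples: "finite (increasing_tuples \<tau> r M N)"
proof -
  have "lattice_box \<tau> M N = (\<lambda>(m, n). of_int m * \<tau> + of_int n) ` (int_box M \<times> int_box N)"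
    by (auto simp: lattice_box_def)
  then have "finite (lattice_box \<tau> M N)"
    by (simp add: finite_int_box)
  then have "finite {ws. set ws \<subseteq> lattice_box \<tau> M N \<and> length ws = r}"
    by (rule finite_lists_length_eq)
  then show ?thesis
    by (rule rev_finite_subset) (auto simp: increasing_tuples_def)
qed

lemma finite_int_partitions: "finite (int_partitions n)"
proof -
  have bounds: "set_mset p \<subseteq> {0..n} \<and> size p \<le> n" if "p \<in> int_partitions n" for p
    using that
  proof (induction p arbitrary: n)
    case (add x p)
    then have "p \<in> int_partitions (\<Sum>\<^sub># p)" "x \<noteq> 0" "n = x + \<Sum>\<^sub># p"
      by (auto simp: int_partitions_def)
    with add.IH[of "\<Sum>\<^sub># p"] show ?case
      by auto
  qed simp
  have "int_partitions n \<subseteq> mset ` {xs. set xs \<subseteq> {0..n} \<and> length xs \<le> n}"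
  proof
    fix p assume "p \<in> int_partitions n"
    moreover obtain xs where "p = mset xs"
      by (metis ex_mset)
    ultimately show "p \<in> mset ` {xs. set xs \<subseteq> {0..n} \<and> length xs \<le> n}"
      using bounds by fastforce
  qed
  moreover have "finite (mset ` {xs. set xs \<subseteq> {0..n} \<and> length xs \<le> n})"
    by (intro finite_imageI finite_lists_length_le) simp
  ultimately show ?thesis
    by (rule finite_subset)
qed

end

theory Submission
  imports Defs
begin

text \<open>
  Both formulas are instances of Newton's identities. Suppose that two sequences \<open>q\<close> and \<open>X\<close> satisfy
  \<open>q k = k X k + (\<Sum>j=1..<k. X j * q (k - j))\<close> for all \<open>k \<ge> 1\<close>; equivalently, the generating
  functions satisfy \<open>(\<Sum>k. q k t\<^sup>k / k) = - ln (1 - (\<Sum>j. X j t\<^sup>j))\<close>. Expanding the logarithm yields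
  \<open>q k = k Tr\<^sub>k (\<phi>\<^bsub>log\<^esub>; X 1, \<dots>, X k)\<close>. Lemma \<open>newton_recursion_imp_trace\<close> proves this by removing one
  part from a partition, and it remains to find the two recursions. In both, the left-hand
  side enters through \<open>\<wp>\<^sub>2\<^bsup>(2k-2)\<^esup> = (2k - 1)! \<wp>\<^sub>2\<^sub>k\<close>.

  First formula. Over a finite box of lattice points, the sums over increasing tuples are the
  elementary symmetric polynomials of the numbers \<open>1 / (z - w)\<^sup>2\<close>, while the sums of
  \<open>1 / (z - w)\<^bsup>2k\<^esup>\<close> are their power sums, so the recursion is the classical
  one (\<open>newton_identity_ordered_tuples\<close>). The power sums converge in the iterated sense. Since the recursion
  expresses each elementary symmetric polynomial by power sums and earlier ones, these converge
  as well, and the recursion passes to the limit (\<open>multi_wp_newton\<close>).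

  Second formula. The recursion to prove is
  \<open>q k = \<wp> q (k - 1) - (\<Sum>j=2..<k. (2j - 1) G\<^sub>2\<^sub>j q (k - j)) - k (2k - 1) G\<^sub>2\<^sub>k\<close> for \<open>k \<ge> 2\<close>, where
  \<open>q 1 = \<wp>\<close> and \<open>q m = \<wp>\<^sub>2\<^sub>m - G\<^sub>2\<^sub>m\<close> for \<open>m \<ge> 2\<close>. The difference of the two sides is elliptic with poles
  at most at the lattice points. The Laurent expansions
  \<open>q m = z\<^bsup>-2m\<^esup> + m (2m + 1) G\<^bsub>2m+2\<^esub> z\<^sup>2 + \<dots>\<close> and \<open>\<wp> = z\<^bsup>-2\<^esup> + 3 G\<^sub>4 z\<^sup>2 + 5 G\<^sub>6 z\<^sup>4 + \<dots>\<close> show that it tends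
  to \<open>0\<close> at the origin, so it is \<open>0\<close> by Liouville's theorem (\<open>wp_centered_relation\<close>).

  The series of exponent at least \<open>3\<close> over the lattice and the series of \<open>\<wp>\<close> converge absolutely.
  The only conditionally convergent sum is \<open>G\<^sub>2\<close>. It is handled by subtracting a telescoping
  series; a similar telescoping argument shows that \<open>\<wp>\<close> is periodic.
\<close>

section \<open>The partition trace of the logarithm\<close>

text \<open>
  Without the factor \<open>(l - 1)!\<close>, the summand of a partition in the trace is a product over its parts,
  independent of \<open>n\<close>. This makes removing a part a local operation.
\<close>

definition part_weight :: "(nat \<Rightarrow> complex) \<Rightarrow> nat multiset \<Rightarrow> complex" where
  "part_weight X p = (\<Prod>j\<in>set_mset p. X j ^ count p j / fact (count p j))"

lemma part_weight_superset:
  assumes "finite A" "set_mset p \<subseteq> A"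
  shows "part_weight X p = (\<Prod>j\<in>A. X j ^ count p j / fact (count p j))"
  unfolding part_weight_def using assms
  by (intro prod.mono_neutral_left) (auto simp: not_in_iff)

text \<open>
  Lowering a multiplicity \<open>m\<close> by one turns \<open>X\<^sup>m / m!\<close> into \<open>X\<^bsup>m-1\<^esup> / (m - 1)!\<close>.
\<close>

lemma count_times_part_weight:
  assumes "j \<in># p"
  shows "of_nat (count p j) * part_weight X p = X j * part_weight X (p - {#j#})"
proof -
  let ?S = "set_mset p - {j}"
  obtain c where c: "count p j = Suc c"
    using assms by (metis count_greater_zero_iff gr0_conv_Suc)
  have eq: "set_mset p = insert j ?S"
    using assms by auto
  have 1: "part_weight X p =
      X j ^ Suc c / fact (Suc c) * (\<Prod>i\<in>?S. X i ^ count p i / fact (count p i))"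
    unfolding part_weight_def by (subst eq, subst prod.insert) (auto simp: c)
  have "part_weight X (p - {#j#}) =
      (\<Prod>i\<in>insert j ?S. X i ^ count (p - {#j#}) i / fact (count (p - {#j#}) i))"
    by (intro part_weight_superset) (auto dest: in_diffD)
  also have "\<dots> = X j ^ c / fact c *
      (\<Prod>i\<in>?S. X i ^ count (p - {#j#}) i / fact (count (p - {#j#}) i))"
    by (subst prod.insert) (auto simp: c)
  also have "(\<Prod>i\<in>?S. X i ^ count (p - {#j#}) i / fact (count (p - {#j#}) i)) =
      (\<Prod>i\<in>?S. X i ^ count p i / fact (count p i))"
    by (intro prod.cong) auto
  finally have 2: "part_weight X (p - {#j#}) =
      X j ^ c / fact c * (\<Prod>i\<in>?S. X i ^ count p i / fact (count p i))" .
  have 3: "of_nat (Suc c) * (X j ^ Suc c / fact (Suc c)) = X j * (X j ^ c / fact c)"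
    by (simp add: divide_simps del: of_nat_Suc)
  show ?thesis
    unfolding 1 2 c mult.assoc[symmetric] 3 ..
qed

lemma parts_of_partition:
  assumes "p \<in> int_partitions n"
  shows "set_mset p \<subseteq> {1..n}"
proof
  fix j assume j: "j \<in># p"
  then have "j \<le> \<Sum>\<^sub># p"
    by (metis le_add1 multi_member_split sum_mset.add_mset)
  then show "j \<in> {1..n}"
    using assms j by (cases j) (auto simp: int_partitions_def)
qed

lemma partition_trace_phi_log:
  "partition_trace n phi_log X = (\<Sum>p\<in>int_partitions n. fact (size p - 1) * part_weight X p)"
  unfolding partition_trace_def
proof (intro sum.cong refl)
  fix p assume p: "p \<in> int_partitions n"
  then have "\<Sum>\<^sub># p = n"
    by (simp add: int_partitions_def)
  then have "phi_log p * (\<Prod>j=1..n. X j ^ count p j) =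
      fact (size p - 1) * (\<Prod>j=1..n. X j ^ count p j / fact (count p j))"
    by (simp add: phi_log_def prod.distrib[symmetric] mult.assoc)
  then show "phi_log p * (\<Prod>j=1..n. X j ^ count p j) = fact (size p - 1) * part_weight X p"
    using part_weight_superset[OF _ parts_of_partition[OF p]] by simp
qed

text \<open>
  A partition of \<open>n\<close> with a marked part value \<open>j\<close> is the same as a partition of \<open>n - j\<close>: remove one copy
  of \<open>j\<close>, or add one.
\<close>

lemma sum_partitions_remove_part:
  fixes f :: "nat \<Rightarrow> nat multiset \<Rightarrow> complex"
  shows "(\<Sum>p\<in>int_partitions n. \<Sum>j\<in>set_mset p. f j (p - {#j#})) =
         (\<Sum>j=1..n. \<Sum>q\<in>int_partitions (n - j). f j q)"
proof -
  have "(\<Sum>(p, j)\<in>Sigma (int_partitions n) set_mset. f j (p - {#j#})) =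
        (\<Sum>(j, q)\<in>Sigma {1..n} (\<lambda>j. int_partitions (n - j)). f j q)"
    by (rule sum.reindex_bij_witness[of _ "\<lambda>(j, q). (add_mset j q, j)"
          "\<lambda>(p, j). (j, p - {#j#})"])
       (use parts_of_partition in \<open>fastforce simp: int_partitions_def sum_mset_diff dest: in_diffD\<close>)+
  then show ?thesis
    by (simp add: sum.Sigma finite_int_partitions)
qed

lemma sum_mset_eq_sum_count:
  fixes p :: "nat multiset"
  shows "\<Sum>\<^sub># p = (\<Sum>j\<in>set_mset p. count p j * j)"
proof -
  have "\<Sum>\<^sub># p = (\<Sum>j\<in>A. count p j * j)" if "finite A" "set_mset p \<subseteq> A" for A
    using that(2)
  proof (induction p)
    case (add x p)
    have "(\<Sum>j\<in>A. count (add_mset x p) j * j) = (\<Sum>j\<in>A. (if j = x then j else 0) + count p j * j)"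
      by (intro sum.cong) auto
    then show ?case
      using add that(1) by (simp add: sum.distrib)
  qed simp
  then show ?thesis by simp
qed

text \<open>
  For a partition \<open>p\<close> of \<open>n\<close> of length \<open>l \<ge> 2\<close>, the sum of \<open>m\<^sub>j (n - j)\<close> over its part values \<open>j\<close>
  is \<open>n l - n = n (l - 1)\<close>. So \<open>n (l - 1)!\<close> splits into the contributions \<open>(n - j) (l - 2)! m\<^sub>j\<close>, which
  belong to the partitions that arise from \<open>p\<close> by removing a part \<open>j\<close>. The partition with the single
  part \<open>n\<close> gives the term \<open>n X\<^sub>n\<close>.
\<close>

lemma partition_trace_recursion:
  assumes "n \<ge> 1"
  shows "of_nat n * partition_trace n phi_log X =
    of_nat n * X n + (\<Sum>j=1..<n. X j * (of_nat (n - j) * partition_trace (n - j) phi_log X))"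
proof -
  let ?g = "\<lambda>j q. of_nat (n - j) * fact (size q - 1) * (X j * part_weight X q)"
  have term_eq: "of_nat n * (fact (size p - 1) * part_weight X p) =
      (if p = {#n#} then of_nat n * X n else 0) + (\<Sum>j\<in>set_mset p. ?g j (p - {#j#}))"
    if p: "p \<in> int_partitions n" for p
  proof (cases "size p \<le> 1")
    case True
    moreover have "p \<noteq> {#}"
      using p assms by (auto simp: int_partitions_def)
    ultimately obtain a where "p = {#a#}"
      by (metis One_nat_def le_Suc_eq le_zero_eq size_1_singleton_mset size_eq_0_iff_empty)
    with p show ?thesis
      by (auto simp: int_partitions_def part_weight_def)
  next
    case False
    define l where "l = size p - 2"
    have l: "size p = Suc (Suc l)"
      using False by (simp add: l_def)
    have count_sum: "(\<Sum>j\<in>set_mset p. of_nat (count p j)) = (of_nat (size p) :: complex)"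
      by (simp add: size_multiset_overloaded_eq)
    have "\<Sum>\<^sub># p = (\<Sum>j\<in>set_mset p. count p j * j)"
      by (rule sum_mset_eq_sum_count)
    then have "(\<Sum>j\<in>set_mset p. count p j * j) = n"
      using p by (simp add: int_partitions_def)
    from arg_cong[OF this, of of_nat]
    have n_sum: "(\<Sum>j\<in>set_mset p. of_nat (count p j) * of_nat j) = (of_nat n :: complex)"
      unfolding of_nat_sum of_nat_mult .
    have "(\<Sum>j\<in>set_mset p. of_nat (n - j) * of_nat (count p j)) =
        (\<Sum>j\<in>set_mset p. of_nat n * of_nat (count p j) - of_nat (count p j) * (of_nat j :: complex))"
      using parts_of_partition[OF p] by (intro sum.cong) (auto simp: of_nat_diff algebra_simps)
    also have "\<dots> = of_nat n * of_nat (Suc l)"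
      unfolding sum_subtractf sum_distrib_left[symmetric] n_sum count_sum
      by (simp add: l algebra_simps)
    finally have sum_eq: "(\<Sum>j\<in>set_mset p. of_nat (n - j) * of_nat (count p j)) =
        (of_nat n * of_nat (Suc l) :: complex)" .
    have "(\<Sum>j\<in>set_mset p. ?g j (p - {#j#})) =
        (\<Sum>j\<in>set_mset p. of_nat (n - j) * of_nat (count p j) * (fact l * part_weight X p))"
      by (intro sum.cong refl)
         (simp add: size_Diff_singleton l count_times_part_weight[symmetric] algebra_simps)
    also have "\<dots> = of_nat n * of_nat (Suc l) * (fact l * part_weight X p)"
      unfolding sum_distrib_right[symmetric] sum_eq ..
    also have "\<dots> = of_nat n * (fact (size p - 1) * part_weight X p)"
      by (simp add: l)
    finally show ?thesis
      using False by auto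
  qed
  have "of_nat n * partition_trace n phi_log X =
      (\<Sum>p\<in>int_partitions n. if p = {#n#} then of_nat n * X n else 0) +
      (\<Sum>p\<in>int_partitions n. \<Sum>j\<in>set_mset p. ?g j (p - {#j#}))"
    unfolding partition_trace_phi_log sum_distrib_left sum.distrib[symmetric]
    by (intro sum.cong refl term_eq)
  also have "(\<Sum>p\<in>int_partitions n. if p = {#n#} then of_nat n * X n else 0) = of_nat n * X n"
    using assms by (simp add: sum.delta finite_int_partitions) (auto simp: int_partitions_def)
  also have "(\<Sum>p\<in>int_partitions n. \<Sum>j\<in>set_mset p. ?g j (p - {#j#})) =
      (\<Sum>j=1..n. \<Sum>q\<in>int_partitions (n - j). ?g j q)"
    by (rule sum_partitions_remove_part)
  also have "\<dots> = (\<Sum>j=1..<n. \<Sum>q\<in>int_partitions (n - j). ?g j q)"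
    by (rule sum.mono_neutral_right) auto
  also have "\<dots> = (\<Sum>j=1..<n. X j * (of_nat (n - j) * partition_trace (n - j) phi_log X))"
    by (simp add: partition_trace_phi_log sum_distrib_left algebra_simps)
  finally show ?thesis .
qed

text \<open>
  The recursion determines \<open>q\<close> from \<open>X\<close>, and \<open>k Tr\<^sub>k\<close> satisfies it.
\<close>

lemma newton_recursion_imp_trace:
  fixes q X :: "nat \<Rightarrow> complex"
  assumes "\<And>k. k \<ge> 1 \<Longrightarrow> q k = of_nat k * X k + (\<Sum>j=1..<k. X j * q (k - j))"
    and "k \<ge> 1"
  shows "q k = of_nat k * partition_trace k phi_log X"
  using \<open>k \<ge> 1\<close>
proof (induction k rule: less_induct)
  case (less k)
  have "(\<Sum>j=1..<k. X j * q (k - j)) =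
      (\<Sum>j=1..<k. X j * (of_nat (k - j) * partition_trace (k - j) phi_log X))"
    using less.IH by (intro sum.cong refl arg_cong2[of _ _ _ _ "(*)"]) auto
  then show ?case
    unfolding assms(1)[OF less.prems] partition_trace_recursion[OF less.prems] by simp
qed

section \<open>Ordered tuples and Newton's identities\<close>

definition ordered_tuples :: "('a \<Rightarrow> 'a \<Rightarrow> bool) \<Rightarrow> 'a set \<Rightarrow> nat \<Rightarrow> 'a list set" where
  "ordered_tuples lt A r = {ws. length ws = r \<and> set ws \<subseteq> A \<and> sorted_wrt lt ws}"

lemma finite_ordered_tuples: "finite A \<Longrightarrow> finite (ordered_tuples lt A r)"
  by (rule finite_subset[OF _ finite_lists_length_eq[of A r]]) (auto simp: ordered_tuples_def)

text \<open>
  The ordered tuples are the finite subsets of \<open>A\<close>, each listed once, so their sums are the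
  elementary symmetric polynomials. In the induction the least element is split off: it can only be
  the head of a tuple.
\<close>

lemma ordered_tuple_sum_fps:
  fixes x :: "'a \<Rightarrow> complex"
  assumes "finite A"
    and "asymp_on A lt" "transp_on A lt" "totalp_on A lt"
  shows "Abs_fps (\<lambda>r. \<Sum>ws\<in>ordered_tuples lt A r. prod_list (map x ws)) =
         (\<Prod>a\<in>A. 1 + fps_const (x a) * fps_X)"
  using assms
proof (induction "card A" arbitrary: A)
  case 0
  then have "A = {}" by simp
  then have "ordered_tuples lt A r = (if r = 0 then {[]} else {})" for r
    by (auto simp: ordered_tuples_def)
  then show ?case
    using \<open>A = {}\<close> by (intro fps_ext) auto
next
  case (Suc n)
  then have "A \<noteq> {}" by auto
  obtain a where a: "a \<in> A" "\<And>b. b \<in> A - {a} \<Longrightarrow> lt a b"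
    using Finite_Set.bex_least_element[OF Suc.prems(1) \<open>A \<noteq> {}\<close> Suc.prems(3,4)] by blast
  have not_lt: "\<not> lt b a" if "b \<in> A" for b
    using a that Suc.prems(2) by (metis Diff_iff asymp_onD singletonD)
  define B where "B = A - {a}"
  have lt_a: "lt a b" if "b \<in> B" for b
    using a(2) that by (simp add: B_def)
  define e where "e A r = (\<Sum>ws\<in>ordered_tuples lt A r. prod_list (map x ws))" for A r
  have finB: "finite B" and A: "A = insert a B" "a \<notin> B"
    using a Suc.prems by (auto simp: B_def)
  have IH: "Abs_fps (e B) = (\<Prod>a\<in>B. 1 + fps_const (x a) * fps_X)"
    unfolding e_def
  proof (rule Suc.hyps)
    show "n = card B" using Suc.hyps(2) A finB by simp
  qed (use Suc.prems finB in \<open>auto simp: B_def intro: asymp_on_subset transp_on_subset totalp_on_subset\<close>)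
  have zero: "e A' 0 = 1" for A'
  proof -
    have "ordered_tuples lt A' 0 = {[]}" by (auto simp: ordered_tuples_def)
    then show ?thesis by (simp add: e_def)
  qed
  have "ordered_tuples lt A (Suc r) = (#) a ` ordered_tuples lt B r \<union> ordered_tuples lt B (Suc r)" for r
  proof (intro equalityI subsetI)
    fix ws assume ws: "ws \<in> ordered_tuples lt A (Suc r)"
    then obtain v vs where v: "ws = v # vs" by (auto simp: ordered_tuples_def length_Suc_conv)
    show "ws \<in> (#) a ` ordered_tuples lt B r \<union> ordered_tuples lt B (Suc r)"
    proof (cases "v = a")
      case True
      have "a \<notin> set vs" using ws v True not_lt by (auto simp: ordered_tuples_def)
      then show ?thesis using ws v True by (auto simp: ordered_tuples_def A)
    next
      case False
      have "a \<notin> set vs" using ws v not_lt by (auto simp: ordered_tuples_def)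
      then show ?thesis using ws v False by (auto simp: ordered_tuples_def A)
    qed
  next
    fix ws assume "ws \<in> (#) a ` ordered_tuples lt B r \<union> ordered_tuples lt B (Suc r)"
    then show "ws \<in> ordered_tuples lt A (Suc r)"
      using A(1) by (auto simp: ordered_tuples_def intro!: lt_a)
  qed
  then have "e A (Suc r) = (\<Sum>ws\<in>(#) a ` ordered_tuples lt B r. prod_list (map x ws)) + e B (Suc r)" for r
    unfolding e_def using A(2)
    by (simp, intro sum.union_disjoint) (auto simp: finite_ordered_tuples finB, auto simp: ordered_tuples_def)
  also have "(\<Sum>ws\<in>(#) a ` ordered_tuples lt B r. prod_list (map x ws)) = x a * e B r" for r
    by (simp add: sum.reindex e_def sum_distrib_left)
  finally have rec: "e A (Suc r) = x a * e B r + e B (Suc r)" for r .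
  have "Abs_fps (e A) = (1 + fps_const (x a) * fps_X) * Abs_fps (e B)"
  proof (rule fps_ext)
    fix r show "fps_nth (Abs_fps (e A)) r =
        fps_nth ((1 + fps_const (x a) * fps_X) * Abs_fps (e B)) r"
      by (cases r) (simp_all add: zero rec distrib_right mult.assoc)
  qed
  then show ?case
    using A finB by (simp add: IH flip: e_def)
qed

text \<open>
  Multiplying out the denominators in the logarithmic derivative of the product: each factor
  contributes \<open>- c t / (1 - c t) = - (c t + c\<^sup>2 t\<^sup>2 + \<dots>)\<close>.
\<close>

lemma newton_log_derivative:
  fixes x :: "'a \<Rightarrow> complex"
  assumes "finite A"
  shows "fps_X * fps_deriv (\<Prod>a\<in>A. 1 - fps_const (x a) * fps_X) =
    - (\<Prod>a\<in>A. 1 - fps_const (x a) * fps_X) * Abs_fps (\<lambda>k. if k = 0 then 0 else \<Sum>a\<in>A. x a ^ k)"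
  using assms
proof (induction rule: finite_induct)
  case empty
  have zero: "Abs_fps (\<lambda>k. if k = 0 then 0 else \<Sum>a\<in>{}. x a ^ k) = 0"
    by (rule fps_ext) simp
  show ?case
    unfolding zero by simp
next
  case (insert b B)
  define F where "F = (\<Prod>a\<in>B. 1 - fps_const (x a) * fps_X)"
  define P where "P = Abs_fps (\<lambda>k. if k = 0 then 0 else \<Sum>a\<in>B. x a ^ k)"
  define Q where "Q = Abs_fps (\<lambda>k. if k = 0 then 0 else x b ^ k)"
  define L where "L = 1 - fps_const (x b) * fps_X"
  have IH: "fps_X * fps_deriv F = - F * P"
    using insert.IH by (simp add: F_def P_def)
  have LQ: "L * Q = fps_const (x b) * fps_X"
  proof (rule fps_ext)
    fix n show "fps_nth (L * Q) n = fps_nth (fps_const (x b) * fps_X) n"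
      by (cases n) (auto simp: L_def Q_def left_diff_distrib mult.assoc)
  qed
  have PQ: "Abs_fps (\<lambda>k. if k = 0 then 0 else \<Sum>a\<in>insert b B. x a ^ k) = P + Q"
    using insert.hyps by (intro fps_ext) (auto simp: P_def Q_def)
  have "fps_X * fps_deriv (L * F) = - (fps_const (x b) * fps_X) * F + L * (fps_X * fps_deriv F)"
    by (simp add: L_def algebra_simps)
  also have "\<dots> = - (L * F) * (P + Q)"
    unfolding IH LQ[symmetric] by (simp add: algebra_simps)
  finally show ?case
    using insert.hyps by (simp add: PQ L_def flip: F_def)
qed

lemma newton_identity_ordered_tuples:
  fixes x :: "'a \<Rightarrow> complex"
  assumes "finite A"
    and "asymp_on A lt" "transp_on A lt" "totalp_on A lt"
    and "k \<ge> 1"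
  defines "h \<equiv> \<lambda>j. (-1) ^ (j + 1) * (\<Sum>ws\<in>ordered_tuples lt A j. prod_list (map x ws))"
  shows "(\<Sum>a\<in>A. x a ^ k) = of_nat k * h k + (\<Sum>j=1..<k. h j * (\<Sum>a\<in>A. x a ^ (k - j)))"
proof -
  let ?F = "\<Prod>a\<in>A. 1 - fps_const (x a) * fps_X"
  let ?P = "Abs_fps (\<lambda>k. if k = 0 then 0 else \<Sum>a\<in>A. x a ^ k)"
  have "?F = Abs_fps (\<lambda>r. \<Sum>ws\<in>ordered_tuples lt A r. prod_list (map (\<lambda>a. - x a) ws))"
    by (subst ordered_tuple_sum_fps) (use assms in \<open>auto simp flip: fps_const_neg\<close>)
  also have "\<dots> = Abs_fps (\<lambda>r. - h r)"
  proof -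
    have neg: "prod_list (map (\<lambda>a. - x a) ws) = (-1) ^ length ws * prod_list (map x ws)" for ws
      by (induction ws) auto
    have "prod_list (map (\<lambda>a. - x a) ws) = (-1) ^ r * prod_list (map x ws)"
      if "ws \<in> ordered_tuples lt A r" for ws r
      using that by (simp add: neg ordered_tuples_def)
    then show ?thesis
      by (intro fps_ext) (simp add: h_def sum_distrib_left sum_negf cong: sum.cong)
  qed
  finally have F: "fps_nth ?F r = - h r" for r by simp
  have "ordered_tuples lt A 0 = {[]}" by (auto simp: ordered_tuples_def)
  then have h0: "h 0 = -1" by (simp add: h_def)
  have "- of_nat k * h k = fps_nth (fps_X * fps_deriv ?F) k"
    using \<open>k \<ge> 1\<close> by (cases k) (simp_all add: F del: of_nat_Suc)
  also have "\<dots> = fps_nth (- ?F * ?P) k"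
    using newton_log_derivative[OF assms(1), of x] by simp
  also have "\<dots> = (\<Sum>j=0..k. h j * fps_nth ?P (k - j))"
    by (simp add: fps_mult_nth F sum_negf)
  also have "\<dots> = h 0 * fps_nth ?P k + (\<Sum>j=1..k. h j * fps_nth ?P (k - j))"
    by (subst sum.atLeast_Suc_atMost) auto
  also have "(\<Sum>j=1..k. h j * fps_nth ?P (k - j)) = (\<Sum>j=1..<k. h j * fps_nth ?P (k - j))"
    by (rule sum.mono_neutral_right) auto
  also have "\<dots> = (\<Sum>j=1..<k. h j * (\<Sum>a\<in>A. x a ^ (k - j)))"
    by (intro sum.cong) auto
  finally show ?thesis
    using \<open>k \<ge> 1\<close> by (simp add: h0 algebra_simps)
qed

section \<open>Iterated limits over integer boxes\<close>

text \<open>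
  The inner limit has to exist for every \<open>M\<close>, so that the value of the nested \<^const>\<open>lim\<close> is
  meaningful and such limits can be added and multiplied.
\<close>

definition itlim :: "(nat \<Rightarrow> nat \<Rightarrow> complex) \<Rightarrow> complex \<Rightarrow> bool" where
  "itlim F L \<longleftrightarrow> (\<exists>G. (\<forall>M. F M \<longlonglongrightarrow> G M) \<and> G \<longlonglongrightarrow> L)"

lemma itlim_imp_lim: "itlim F L \<Longrightarrow> lim (\<lambda>M. lim (F M)) = L"
proof -
  assume "itlim F L"
  then obtain G where G: "\<And>M. F M \<longlonglongrightarrow> G M" "G \<longlonglongrightarrow> L"
    by (auto simp: itlim_def)
  have "(\<lambda>M. lim (F M)) = G"
    using limI[OF G(1)] by auto
  then show ?thesis
    using limI[OF G(2)] by simp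
qed

lemma itlim_const: "itlim (\<lambda>M N. c) c"
  unfolding itlim_def by (intro exI[of _ "\<lambda>_. c"]) auto

lemma itlim_add: "itlim F K \<Longrightarrow> itlim G L \<Longrightarrow> itlim (\<lambda>M N. F M N + G M N) (K + L)"
  unfolding itlim_def by (elim exE conjE) (rule exI, auto intro!: tendsto_add)

lemma itlim_mult: "itlim F K \<Longrightarrow> itlim G L \<Longrightarrow> itlim (\<lambda>M N. F M N * G M N) (K * L)"
  unfolding itlim_def by (elim exE conjE) (rule exI, auto intro!: tendsto_mult)

lemma itlim_cmult: "itlim G L \<Longrightarrow> itlim (\<lambda>M N. c * G M N) (c * L)"
  by (intro itlim_mult itlim_const)

lemma itlim_diff: "itlim F K \<Longrightarrow> itlim G L \<Longrightarrow> itlim (\<lambda>M N. F M N - G M N) (K - L)"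
  using itlim_add[OF _ itlim_cmult[of G L "-1"], of F K] by simp

lemma itlim_sum:
  "(\<And>i. i \<in> A \<Longrightarrow> itlim (F i) (L i)) \<Longrightarrow> itlim (\<lambda>M N. \<Sum>i\<in>A. F i M N) (\<Sum>i\<in>A. L i)"
  by (induction A rule: infinite_finite_induct) (auto intro: itlim_const itlim_add)

lemma filterlim_int_box: "filterlim int_box (finite_subsets_at_top UNIV) sequentially"
  unfolding filterlim_finite_subsets_at_top
proof (intro allI impI)
  fix X :: "int set" assume X: "finite X \<and> X \<subseteq> UNIV"
  then obtain B where B: "\<And>x. x \<in> X \<Longrightarrow> \<bar>x\<bar> \<le> B"
    by (metis bdd_above_finite bdd_above.unfold finite_imageI image_eqI)
  have "X \<subseteq> int_box N" if "N \<ge> nat B + 1" for N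
  proof
    fix x assume "x \<in> X"
    then show "x \<in> int_box N"
      using B[of x] that by (simp add: int_box_def)
  qed
  then show "\<forall>\<^sub>F N in sequentially. finite (int_box N) \<and> X \<subseteq> int_box N \<and> int_box N \<subseteq> UNIV"
    by (intro eventually_sequentiallyI[of "nat B + 1"]) (auto simp: finite_int_box)
qed

lemma has_sum_imp_int_box_limit:
  fixes f :: "int \<Rightarrow> complex"
  assumes "(f has_sum S) UNIV"
  shows "(\<lambda>N. \<Sum>n\<in>int_box N. f n) \<longlonglongrightarrow> S"
  using filterlim_compose[OF assms[unfolded has_sum_def] filterlim_int_box] .

text \<open>
  Fubini for absolutely convergent double series: the rows converge, and then their sums.
\<close>

lemma has_sum_imp_itlim:
  fixes f :: "int \<times> int \<Rightarrow> complex"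
  assumes "(f has_sum S) UNIV"
  shows "itlim (\<lambda>M N. \<Sum>p\<in>int_box M \<times> int_box N. f p) S"
proof -
  have S: "(f has_sum S) (UNIV \<times> UNIV)"
    using assms by simp
  have "(\<lambda>n. f (m, n)) summable_on UNIV" for m
    using summable_on_SigmaD1[of "curry f" UNIV "\<lambda>_. UNIV" m] has_sum_imp_summable[OF S]
    by (simp add: curry_def)
  then have row: "((\<lambda>n. f (m, n)) has_sum (\<Sum>\<^sub>\<infinity>n. f (m, n))) UNIV" for m
    by simp
  have "((\<lambda>m. \<Sum>\<^sub>\<infinity>n. f (m, n)) has_sum S) UNIV"
    by (rule has_sum_SigmaD[OF S row])
  then have "(\<lambda>M. \<Sum>m\<in>int_box M. \<Sum>\<^sub>\<infinity>n. f (m, n)) \<longlonglongrightarrow> S"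
    by (rule has_sum_imp_int_box_limit)
  moreover have "(\<lambda>N. \<Sum>p\<in>int_box M \<times> int_box N. f p) \<longlonglongrightarrow> (\<Sum>m\<in>int_box M. \<Sum>\<^sub>\<infinity>n. f (m, n))" for M
    by (simp add: sum.cartesian_product' finite_int_box tendsto_sum has_sum_imp_int_box_limit row)
  ultimately show ?thesis
    unfolding itlim_def by (intro exI[of _ "\<lambda>M. \<Sum>m\<in>int_box M. \<Sum>\<^sub>\<infinity>n. f (m, n)"]) simp
qed

text \<open>
  The sum over the box of radius \<open>N + 1\<close> telescopes to \<open>b (- N - 1) - b N\<close>.
\<close>

lemma telescoping_int_box:
  fixes b :: "int \<Rightarrow> complex"
  assumes "(\<lambda>N. b (int N)) \<longlonglongrightarrow> 0" "(\<lambda>N. b (- int N)) \<longlonglongrightarrow> 0"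
  shows "(\<lambda>N. \<Sum>n\<in>int_box N. b (n - 1) - b n) \<longlonglongrightarrow> 0"
proof -
  have "(\<Sum>n\<in>int_box (Suc N). b (n - 1) - b n) = b (- int (Suc N)) - b (int N)" for N
  proof (induction N)
    case 0
    have "int_box (Suc 0) = {0}"
      by (auto simp: int_box_def)
    then show ?case by simp
  next
    case (Suc N)
    have box: "int_box (Suc (Suc N)) = insert (int (Suc N)) (insert (- int (Suc N)) (int_box (Suc N)))"
      by (auto simp: int_box_def)
    have notin: "int (Suc N) \<notin> insert (- int (Suc N)) (int_box (Suc N))"
        "- int (Suc N) \<notin> int_box (Suc N)"
      by (auto simp: int_box_def)
    have "(\<Sum>n\<in>int_box (Suc (Suc N)). b (n - 1) - b n) =
        (b (int (Suc N) - 1) - b (int (Suc N))) + ((b (- int (Suc N) - 1) - b (- int (Suc N))) +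
        (\<Sum>n\<in>int_box (Suc N). b (n - 1) - b n))"
      unfolding box using notin finite_int_box[of "Suc N"] by (subst sum.insert; simp)
    also have "\<dots> = b (- int (Suc (Suc N))) - b (int (Suc N))"
    proof -
      have eqs: "int (Suc N) - 1 = int N" "- int (Suc N) - 1 = - int (Suc (Suc N))"
        by auto
      show ?thesis
        unfolding Suc.IH eqs by (simp del: of_nat_Suc)
    qed
    finally show ?case .
  qed
  moreover have "(\<lambda>N. b (- int (Suc N)) - b (int N)) \<longlonglongrightarrow> 0 - 0"
    by (intro tendsto_diff assms(1) LIMSEQ_Suc[OF assms(2)])
  ultimately have "(\<lambda>N. \<Sum>n\<in>int_box (Suc N). b (n - 1) - b n) \<longlonglongrightarrow> 0"
    by simp
  then show ?thesis
    by (rule LIMSEQ_imp_Suc)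
qed

lemma telescoping_itlim:
  fixes b :: "int \<Rightarrow> int \<Rightarrow> complex"
  assumes "\<And>m. (\<lambda>N. b m (int N)) \<longlonglongrightarrow> 0" "\<And>m. (\<lambda>N. b m (- int N)) \<longlonglongrightarrow> 0"
  shows "itlim (\<lambda>M N. \<Sum>(m, n)\<in>int_box M \<times> int_box N. b m (n - 1) - b m n) 0"
proof -
  have "(\<lambda>N. \<Sum>(m, n)\<in>int_box M \<times> int_box N. b m (n - 1) - b m n) \<longlonglongrightarrow> (\<Sum>m\<in>int_box M. 0)" for M
    unfolding sum.cartesian_product[symmetric]
    by (intro tendsto_sum telescoping_int_box assms)
  then show ?thesis
    unfolding itlim_def by (intro exI[of _ "\<lambda>M. 0"]) simp
qed

text \<open>
  If a telescoping double series converges absolutely, then its sum can be computed row by row,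
  and each row contributes \<open>0\<close>.
\<close>

lemma telescoping_has_sum:
  fixes b :: "int \<Rightarrow> int \<Rightarrow> complex"
  assumes "\<And>m. (\<lambda>N. b m (int N)) \<longlonglongrightarrow> 0" "\<And>m. (\<lambda>N. b m (- int N)) \<longlonglongrightarrow> 0"
    and "((\<lambda>(m, n). b m (n - 1) - b m n) has_sum S) UNIV"
  shows "S = 0"
  using itlim_imp_lim[OF telescoping_itlim[OF assms(1,2)]] itlim_imp_lim[OF has_sum_imp_itlim[OF assms(3)]]
  by simp

lemma inverse_power_progression_tendsto_0:
  fixes c \<alpha> :: complex
  assumes "\<alpha> \<noteq> 0" "k > 0"
  shows "(\<lambda>N. 1 / (c + of_int (int N) * \<alpha>) ^ k) \<longlonglongrightarrow> 0"
    and "(\<lambda>N. 1 / (c + of_int (- int N) * \<alpha>) ^ k) \<longlonglongrightarrow> 0"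
proof -
  have *: "(\<lambda>N. 1 / (c + of_nat N * \<beta>) ^ k) \<longlonglongrightarrow> 0" if "\<beta> \<noteq> 0" for \<beta>
  proof -
    have "filterlim (\<lambda>N. \<beta> * of_nat N) at_infinity sequentially"
      by (rule tendsto_mult_filterlim_at_infinity[OF tendsto_const that tendsto_of_nat])
    then have "filterlim (\<lambda>N. c + \<beta> * of_nat N) at_infinity sequentially"
      by (rule tendsto_add_filterlim_at_infinity[OF tendsto_const])
    then have "(\<lambda>N. inverse (c + \<beta> * of_nat N)) \<longlonglongrightarrow> 0"
      by (rule filterlim_compose[OF tendsto_inverse_0])
    then have "(\<lambda>N. inverse (c + \<beta> * of_nat N) ^ k) \<longlonglongrightarrow> 0 ^ k"
      by (rule tendsto_power)
    then show ?thesis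
      using assms(2) by (simp add: inverse_eq_divide power_one_over mult.commute zero_power)
  qed
  show "(\<lambda>N. 1 / (c + of_int (int N) * \<alpha>) ^ k) \<longlonglongrightarrow> 0"
    using *[of \<alpha>] assms by simp
  show "(\<lambda>N. 1 / (c + of_int (- int N) * \<alpha>) ^ k) \<longlonglongrightarrow> 0"
    using *[of "- \<alpha>"] assms by simp
qed

section \<open>The period lattice\<close>

lemma summable_on_int:
  fixes f :: "int \<Rightarrow> real"
  assumes "(\<lambda>n. f (int n)) summable_on UNIV" "(\<lambda>n. f (- int n)) summable_on UNIV"
  shows "f summable_on UNIV"
proof -
  have "f summable_on range int" "f summable_on range (\<lambda>n. - int n)"
    using assms by (subst summable_on_reindex; simp add: o_def inj_on_def)+
  then have "f summable_on (range int \<union> range (\<lambda>n. - int n))"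
    by (rule summable_on_union)
  moreover have "range int \<union> range (\<lambda>n. - int n) = UNIV"
    by (auto intro: int_cases2)
  ultimately show ?thesis by simp
qed

lemma summable_on_product_of_ints:
  "(\<lambda>(m::int, n::int). (1 + \<bar>real_of_int m\<bar>) powr (-3/2) * (1 + \<bar>real_of_int n\<bar>) powr (-3/2))
     summable_on UNIV"
proof -
  define u where "u n = (1 + \<bar>real_of_int n\<bar>) powr (-3/2)" for n
  have u_abs: "\<bar>u n\<bar> = u n" for n
    by (simp add: u_def)
  have "summable (\<lambda>n. real n powr (-3/2))"
    by (simp add: summable_real_powr_iff)
  then have "summable (\<lambda>n. real (Suc n) powr (-3/2))"
    by (subst summable_Suc_iff)
  then have "summable (\<lambda>n. norm (u (int n)))" "summable (\<lambda>n. norm (u (- int n)))"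
    by (simp_all add: u_def add.commute)
  then have u: "u summable_on UNIV"
    by (intro summable_on_int norm_summable_imp_summable_on)
  have "(\<lambda>p. norm ((\<lambda>(m, n). u m * u n) p)) summable_on UNIV \<times> UNIV"
    unfolding Infinite_Sum.abs_summable_on_Sigma_iff
    using u by (simp add: u_abs abs_mult summable_on_cmult_right infsum_cmult_right' summable_on_cmult_left)
  then have "(\<lambda>(m, n). u m * u n) summable_on UNIV \<times> UNIV"
    by (rule abs_summable_summable)
  then show ?thesis
    by (simp add: u_def)
qed

text \<open>
  Both \<open>1 + a\<close> and \<open>1 + b\<close> are at most \<open>2 (a + b)\<close>. This bounds the cubic term of the lattice sum by a
  product of two convergent one-variable series.
\<close>

lemma two_variable_power_bound:
  fixes a b :: real
  assumes "a \<ge> 0" "b \<ge> 0" "a + b \<ge> 1"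
  shows "1 / (a + b) ^ 3 \<le> 8 * ((1 + a) powr (-3/2) * (1 + b) powr (-3/2))"
proof -
  define s where "s = a + b"
  have s: "s \<ge> 1"
    using assms by (simp add: s_def)
  have "(1 + a) * (1 + b) \<le> (2 * s) * (2 * s)"
    using assms by (intro mult_mono) (auto simp: s_def)
  then have "((1 + a) * (1 + b)) powr (3/2) \<le> ((2 * s) * (2 * s)) powr (3/2)"
    using assms by (intro powr_mono2) auto
  also have "\<dots> = (2 * s) powr (3/2 + 3/2)"
    unfolding powr_add by (rule powr_mult)
  also have "\<dots> = 8 * s ^ 3"
    using s powr_realpow[of "2 * s" 3] by (simp add: power_mult_distrib)
  finally have le: "(1 + a) powr (3/2) * (1 + b) powr (3/2) \<le> 8 * s ^ 3"
    using assms by (simp add: powr_mult)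
  have pos: "(1 + a) powr (3/2) * (1 + b) powr (3/2) > 0" "s ^ 3 > 0"
    using assms s by auto
  have "8 * ((1 + a) powr (-3/2) * (1 + b) powr (-3/2)) =
      8 / ((1 + a) powr (3/2) * (1 + b) powr (3/2))"
    by (simp add: powr_minus divide_simps)
  also have "\<dots> \<ge> 1 / s ^ 3"
    using le pos by (simp add: field_simps)
  finally show ?thesis
    by (simp add: s_def)
qed

locale half_plane_lattice =
  fixes \<tau> :: complex
  assumes Im_pos: "Im \<tau> > 0"
begin

abbreviation \<Lambda> :: "complex set" where "\<Lambda> \<equiv> period_lattice \<tau>"

definition point :: "int \<times> int \<Rightarrow> complex" where
  "point = (\<lambda>(m, n). of_int m * \<tau> + of_int n)"

lemma inj_point: "inj point"
proof (rule injI)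
  fix p q assume eq: "point p = point q"
  from arg_cong[OF eq, of Im] have "fst p = fst q"
    using Im_pos by (simp add: point_def split: prod.splits)
  moreover from this eq have "snd p = snd q"
    by (simp add: point_def split: prod.splits)
  ultimately show "p = q"
    by (simp add: prod_eq_iff)
qed

lemma range_point: "\<Lambda> = range point"
  by (auto simp: period_lattice_def point_def)

lemma lattice_box_eq: "lattice_box \<tau> M N = point ` (int_box M \<times> int_box N)"
  by (auto simp: lattice_box_def point_def)

lemma finite_lattice_box: "finite (lattice_box \<tau> M N)"
  by (simp add: lattice_box_eq finite_int_box)

lemma lattice_box_subset: "lattice_box \<tau> M N \<subseteq> \<Lambda>"
  by (auto simp: lattice_box_eq range_point)

lemma sum_lattice_box: "(\<Sum>w\<in>lattice_box \<tau> M N. f w) = (\<Sum>p\<in>int_box M \<times> int_box N. f (point p))"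
  unfolding lattice_box_eq by (simp add: sum.reindex inj_on_subset[OF inj_point])

lemma zero_mem [simp]: "0 \<in> \<Lambda>"
  unfolding period_lattice_def by (rule CollectI, rule exI[of _ 0], rule exI[of _ 0]) simp

lemma one_mem [simp]: "1 \<in> \<Lambda>"
  unfolding period_lattice_def by (rule CollectI, rule exI[of _ 0], rule exI[of _ 1]) simp

lemma tau_mem [simp]: "\<tau> \<in> \<Lambda>"
  unfolding period_lattice_def by (rule CollectI, rule exI[of _ 1], rule exI[of _ 0]) simp

lemma add_mem: "v \<in> \<Lambda> \<Longrightarrow> w \<in> \<Lambda> \<Longrightarrow> v + w \<in> \<Lambda>"
proof -
  assume "v \<in> \<Lambda>" "w \<in> \<Lambda>"
  then obtain m n m' n' where
    "v = of_int m * \<tau> + of_int n" "w = of_int m' * \<tau> + of_int n'"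
    by (auto simp: period_lattice_def)
  then have "v + w = of_int (m + m') * \<tau> + of_int (n + n')"
    by (simp add: algebra_simps)
  then show ?thesis
    unfolding period_lattice_def by blast
qed

lemma uminus_mem: "w \<in> \<Lambda> \<Longrightarrow> - w \<in> \<Lambda>"
proof -
  assume "w \<in> \<Lambda>"
  then obtain m n where "w = of_int m * \<tau> + of_int n"
    by (auto simp: period_lattice_def)
  then have "- w = of_int (- m) * \<tau> + of_int (- n)"
    by (simp add: algebra_simps)
  then show ?thesis
    unfolding period_lattice_def by blast
qed

lemma add_mem_iff: "\<omega> \<in> \<Lambda> \<Longrightarrow> z + \<omega> \<in> \<Lambda> \<longleftrightarrow> z \<in> \<Lambda>"
  using add_mem[of z \<omega>] add_mem[of "z + \<omega>" "- \<omega>"] uminus_mem[of \<omega>] by auto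

lemma bij_add: "\<omega> \<in> \<Lambda> \<Longrightarrow> bij_betw (\<lambda>w. w + \<omega>) \<Lambda> \<Lambda>"
  by (rule bij_betw_byWitness[of _ "\<lambda>w. w - \<omega>"])
     (use add_mem[of _ "- \<omega>"] in \<open>auto simp: add_mem uminus_mem\<close>)

lemma bij_uminus: "bij_betw uminus (\<Lambda> - {0}) (\<Lambda> - {0})"
  by (rule bij_betw_byWitness[of _ uminus]) (auto simp: uminus_mem)

text \<open>
  The imaginary part controls \<open>m\<close>, and then \<open>n\<close> differs from the lattice point by \<open>m \<tau>\<close>.
\<close>

lemma coordinates_bound: "\<exists>K>0. \<forall>m n. \<bar>real_of_int m\<bar> + \<bar>real_of_int n\<bar> \<le> K * norm (point (m, n))"
proof -
  define K where "K = 1 / Im \<tau> + 1 + norm \<tau> / Im \<tau>"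
  have "\<bar>real_of_int m\<bar> + \<bar>real_of_int n\<bar> \<le> K * norm (point (m, n))" for m n
  proof -
    let ?w = "point (m, n)"
    have "\<bar>real_of_int m\<bar> * Im \<tau> = \<bar>Im ?w\<bar>"
      using Im_pos by (simp add: point_def abs_mult)
    also have "\<dots> \<le> norm ?w"
      by (rule abs_Im_le_cmod)
    finally have m: "\<bar>real_of_int m\<bar> \<le> norm ?w / Im \<tau>"
      using Im_pos by (simp add: pos_le_divide_eq)
    have "of_int n = ?w - of_int m * \<tau>"
      by (simp add: point_def)
    then have "\<bar>real_of_int n\<bar> \<le> norm ?w + \<bar>real_of_int m\<bar> * norm \<tau>"
      by (metis norm_triangle_ineq4 norm_mult norm_of_int)
    also have "\<dots> \<le> norm ?w + norm ?w / Im \<tau> * norm \<tau>"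
      using m by (intro add_left_mono mult_right_mono) auto
    finally show ?thesis
      using m by (simp add: K_def field_simps)
  qed
  moreover have "K > 0"
    using Im_pos by (simp add: K_def add_pos_nonneg)
  ultimately show ?thesis by blast
qed

lemma finite_lattice_norm_le: "finite {w \<in> \<Lambda>. norm w \<le> R}"
proof -
  obtain K where K: "K > 0" "\<And>m n. \<bar>real_of_int m\<bar> + \<bar>real_of_int n\<bar> \<le> K * norm (point (m, n))"
    using coordinates_bound by blast
  define B where "B = \<lceil>K * R\<rceil>"
  have "{w \<in> \<Lambda>. norm w \<le> R} \<subseteq> point ` ({-B..B} \<times> {-B..B})"
  proof
    fix w assume "w \<in> {w \<in> \<Lambda>. norm w \<le> R}"
    then obtain m n where w: "w = point (m, n)" "norm w \<le> R"
      by (auto simp: range_point)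
    have "K * norm w \<le> K * R"
      using w(2) K(1) by simp
    then have "\<bar>real_of_int m\<bar> + \<bar>real_of_int n\<bar> \<le> K * R"
      using K(2)[of m n] unfolding w(1) by linarith
    then have "real_of_int \<bar>m\<bar> \<le> of_int B" "real_of_int \<bar>n\<bar> \<le> of_int B"
      unfolding B_def using le_of_int_ceiling[of "K * R"] by linarith+
    then have "\<bar>m\<bar> \<le> B" "\<bar>n\<bar> \<le> B"
      by linarith+
    then show "w \<in> point ` ({-B..B} \<times> {-B..B})"
      unfolding w(1) by (intro imageI) auto
  qed
  then show ?thesis
    by (rule finite_subset) auto
qed

text \<open>
  Every ball meets the lattice in a finite set, so no set of lattice points has a limit point.
\<close>

lemma closed_sublattice: "X \<subseteq> \<Lambda> \<Longrightarrow> closed X"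
proof -
  assume X: "X \<subseteq> \<Lambda>"
  have "finite (X \<inter> ball z 1)" for z
  proof (rule finite_subset[OF _ finite_lattice_norm_le[of "norm z + 1"]])
    have "norm w \<le> norm z + 1" if "dist z w < 1" for w
      using that norm_triangle_ineq2[of w z] by (simp add: dist_norm norm_minus_commute)
    then show "X \<inter> ball z 1 \<subseteq> {w \<in> \<Lambda>. norm w \<le> norm z + 1}"
      using X by auto
  qed
  then show ?thesis
    unfolding closed_limpt islimpt_eq_infinite_ball by (metis zero_less_one)
qed

lemma summable_inverse_cube: "(\<lambda>w. 1 / norm w ^ 3) summable_on \<Lambda>"
proof -
  obtain K where K: "K > 0" "\<And>m n. \<bar>real_of_int m\<bar> + \<bar>real_of_int n\<bar> \<le> K * norm (point (m, n))"
    using coordinates_bound by blast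
  have "1 / norm (point (m, n)) ^ 3 \<le>
      8 * K ^ 3 * ((1 + \<bar>real_of_int m\<bar>) powr (-3/2) * (1 + \<bar>real_of_int n\<bar>) powr (-3/2))" for m n
  proof (cases "(m, n) = (0, 0)")
    case True
    then show ?thesis
      using K(1) by (simp add: point_def)
  next
    case False
    let ?s = "\<bar>real_of_int m\<bar> + \<bar>real_of_int n\<bar>"
    have s: "?s \<ge> 1"
      using False by (auto simp flip: of_int_abs)
    have "?s ^ 3 \<le> K ^ 3 * norm (point (m, n)) ^ 3"
      using K(2)[of m n] s by (simp add: power_mono flip: power_mult_distrib)
    moreover have pos: "0 < norm (point (m, n))"
      using K(2)[of m n] s K(1) by (smt (verit) mult_pos_neg mult_eq_0_iff norm_ge_zero)
    ultimately have "1 / norm (point (m, n)) ^ 3 \<le> K ^ 3 * (1 / ?s ^ 3)"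
      using s by (simp add: field_simps)
    also have "\<dots> \<le> K ^ 3 *
        (8 * ((1 + \<bar>real_of_int m\<bar>) powr (-3/2) * (1 + \<bar>real_of_int n\<bar>) powr (-3/2)))"
      using K(1) s by (intro mult_left_mono two_variable_power_bound) auto
    finally show ?thesis
      by (simp add: algebra_simps)
  qed
  then have "(\<lambda>p. 1 / norm (point p) ^ 3) summable_on UNIV"
    by (intro summable_on_comparison_test[OF
          summable_on_cmult_right[OF summable_on_product_of_ints, of "8 * K ^ 3"]]) auto
  then show ?thesis
    unfolding range_point summable_on_reindex[OF inj_point] by (simp add: o_def)
qed

text \<open>
  A ball contains only finitely many lattice points, so a comparison with \<open>1 / \<bar>w\<bar>\<^sup>3\<close> outside the ball
  suffices.
\<close>

lemma summable_on_lattice: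
  fixes f :: "complex \<Rightarrow> complex"
  assumes "\<And>w. w \<in> \<Lambda> \<Longrightarrow> norm w \<ge> R \<Longrightarrow> norm (f w) \<le> C / norm w ^ 3"
    and "X \<subseteq> \<Lambda>"
  shows "f summable_on X"
proof -
  have "(\<lambda>w. C * (1 / norm w ^ 3)) summable_on {w \<in> \<Lambda>. norm w \<ge> R}"
    by (intro summable_on_cmult_right summable_on_subset[OF summable_inverse_cube]) auto
  then have "(\<lambda>w. norm (f w)) summable_on {w \<in> \<Lambda>. norm w \<ge> R}"
    by (rule summable_on_comparison_test) (use assms in auto)
  then have "f summable_on {w \<in> \<Lambda>. norm w \<ge> R}"
    by (rule abs_summable_summable)
  moreover have "f summable_on {w \<in> \<Lambda>. norm w \<le> R}"
    by (intro summable_on_finite finite_lattice_norm_le)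
  ultimately have "f summable_on ({w \<in> \<Lambda>. norm w \<ge> R} \<union> {w \<in> \<Lambda>. norm w \<le> R})"
    by (rule summable_on_union)
  then show ?thesis
    by (rule summable_on_subset) (use assms in auto)
qed

lemma has_sum_lattice_imp_itlim:
  assumes "(f has_sum S) \<Lambda>"
  shows "itlim (\<lambda>M N. \<Sum>w\<in>lattice_box \<tau> M N. f w) S"
proof -
  have "((f \<circ> point) has_sum S) UNIV"
    using assms unfolding range_point has_sum_reindex[OF inj_point] .
  from has_sum_imp_itlim[OF this] show ?thesis
    by (simp add: sum_lattice_box)
qed

lemma norm_diff_ge:
  fixes z w :: complex
  assumes "norm w \<ge> 2 * norm z"
  shows "norm (z - w) \<ge> norm w / 2"
  using assms norm_triangle_ineq2[of w z] by (simp add: norm_minus_commute)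

lemma summable_inverse_power:
  assumes "n \<ge> 3" "X \<subseteq> \<Lambda>"
  shows "(\<lambda>w. 1 / (z - w) ^ n) summable_on X"
proof (rule summable_on_lattice[OF _ assms(2)])
  fix w :: complex assume w: "norm w \<ge> 2 * norm z + 1"
  have w1: "norm w \<ge> 1"
    using w norm_ge_zero[of z] by linarith
  have "(norm w / 2) ^ n \<le> norm (z - w) ^ n"
    using w by (intro power_mono norm_diff_ge) auto
  moreover have "norm w ^ 3 \<le> norm w ^ n"
    using w1 assms(1) by (intro power_increasing) auto
  ultimately have "norm w ^ 3 \<le> 2 ^ n * norm (z - w) ^ n"
    by (simp add: power_divide field_simps)
  moreover have "norm (z - w) > 0"
    using norm_diff_ge[of z w] w w1 by linarith
  moreover have "norm w ^ 3 > 0"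
    using w1 by (intro zero_less_power) linarith
  ultimately show "norm (1 / (z - w) ^ n) \<le> 2 ^ n / norm w ^ 3"
    by (simp add: norm_divide norm_power field_simps)
qed

text \<open>
  Coordinates of lattice points are unique, so the order is the lexicographic order of the coordinates.
\<close>

lemma lattice_less_order:
  assumes "X \<subseteq> \<Lambda>"
  shows "asymp_on X (lattice_less \<tau>)" "transp_on X (lattice_less \<tau>)" "totalp_on X (lattice_less \<tau>)"
proof -
  have less: "lattice_less \<tau> (point p) (point q) \<longleftrightarrow>
      fst p < fst q \<or> fst p = fst q \<and> snd p < snd q" for p q
  proof -
    have eq: "lattice_less \<tau> (point p) (point q) \<longleftrightarrow> (\<exists>p' q'. point p = point p' \<and> point q = point q' \<and>
        (fst p' < fst q' \<or> fst p' = fst q' \<and> snd p' < snd q'))"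
      by (simp add: lattice_less_def point_def split_paired_Ex)
    show ?thesis
      unfolding eq inj_eq[OF inj_point] by auto
  qed
  have "asymp_on \<Lambda> (lattice_less \<tau>)"
    unfolding range_point asymp_on_image less by (rule asymp_onI) auto
  moreover have "transp_on \<Lambda> (lattice_less \<tau>)"
    unfolding range_point transp_on_image less by (rule transp_onI) auto
  moreover have "totalp_on \<Lambda> (lattice_less \<tau>)"
    unfolding range_point totalp_on_image[OF inj_point] less
    by (rule totalp_onI) (auto simp: prod_eq_iff)
  ultimately show "asymp_on X (lattice_less \<tau>)" "transp_on X (lattice_less \<tau>)" "totalp_on X (lattice_less \<tau>)"
    using assms by (auto intro: asymp_on_subset transp_on_subset totalp_on_subset)
qed

end

section \<open>Eisenstein series\<close>

context half_plane_lattice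
begin

text \<open>
  The series of \<open>1 / w\<^sup>2\<close> is compared with that of \<open>1 / (w\<^sup>2 - 1/4) = 1 / (w - 1/2) - 1 / (w + 1/2)\<close>. The second
  series telescopes along each row. The difference of the two is absolutely convergent, because
  its terms are of order \<open>1 / \<bar>w\<bar>\<^sup>4\<close>. The shift by \<open>1/2\<close> avoids all lattice points.
\<close>

lemma itlim_eisenstein_2_exists: "\<exists>L. itlim (\<lambda>M N. \<Sum>w\<in>lattice_box \<tau> M N. 1 / w\<^sup>2) L"
proof -
  define F where "F w = 1 / w\<^sup>2 - 1 / (w\<^sup>2 - 1/4)" for w :: complex
  define b where "b m n = 1 / ((of_int m * \<tau> + 1/2) + of_int n * 1) ^ 1" for m n
  have "F summable_on \<Lambda>"
  proof (rule summable_on_lattice[where R = 1 and C = 1])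
    fix w assume "w \<in> \<Lambda>" and w: "norm w \<ge> 1"
    have w0: "w \<noteq> 0"
      using w by auto
    have "norm w ^ 2 - 1/4 \<le> norm (w\<^sup>2 - 1/4)"
      using norm_triangle_ineq2[of "w\<^sup>2" "1/4"] by (simp add: norm_power norm_divide)
    moreover have "1 \<le> norm w ^ 2" "norm w \<le> norm w ^ 2"
      using w self_le_power[of "norm w" 2] by (auto simp: one_le_power)
    ultimately have ge: "norm w \<le> 4 * norm (w\<^sup>2 - 1/4)" and pos: "norm (w\<^sup>2 - 1/4) > 0"
      by linarith+
    have "F w = - (1/4) / (w\<^sup>2 * (w\<^sup>2 - 1/4))"
      using w0 pos unfolding F_def by (simp add: field_simps)
    then have "norm (F w) = 1 / (norm w ^ 2 * (4 * norm (w\<^sup>2 - 1/4)))"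
      by (simp add: norm_divide norm_mult norm_power)
    also have "\<dots> \<le> 1 / (norm w ^ 2 * norm w)"
      using ge pos w0 by (intro divide_left_mono mult_left_mono mult_pos_pos) auto
    finally show "norm (F w) \<le> 1 / norm w ^ 3"
      by (simp add: power3_eq_cube power2_eq_square)
  qed auto
  then have 1: "itlim (\<lambda>M N. \<Sum>w\<in>lattice_box \<tau> M N. F w) (infsum F \<Lambda>)"
    by (intro has_sum_lattice_imp_itlim) simp
  have 2: "itlim (\<lambda>M N. \<Sum>(m, n)\<in>int_box M \<times> int_box N. b m (n - 1) - b m n) 0"
    unfolding b_def by (intro telescoping_itlim inverse_power_progression_tendsto_0) auto
  \<comment> \<open>no lattice point is \<open>\<plusminus>1/2\<close>, as a real lattice point is an integer\<close>
  have half: "point p \<noteq> 1/2" "point p \<noteq> - 1/2" for p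
  proof -
    have "2 * point p \<noteq> of_int (2 * k + 1)" for k
    proof
      assume eq: "2 * point p = of_int (2 * k + 1)"
      obtain m n where p: "p = (m, n)" by (cases p)
      from arg_cong[OF eq, of Im] have "m = 0"
        using Im_pos by (simp add: point_def p)
      with eq have "of_int (2 * n) = (of_int (2 * k + 1) :: complex)"
        by (simp add: point_def p)
      then have "2 * n = 2 * k + 1"
        unfolding of_int_eq_iff .
      then show False by presburger
    qed
    from this[of 0] this[of "-1"] show "point p \<noteq> 1/2" "point p \<noteq> - 1/2"
      by (auto simp: mult.commute)
  qed
  have "1 / (point p)\<^sup>2 = F (point p) + (case p of (m, n) \<Rightarrow> b m (n - 1) - b m n)" for p
  proof -
    obtain m n where p: "p = (m, n)" by (cases p)
    define w where "w = point p"
    have ne: "w - 1/2 \<noteq> 0" "w + 1/2 \<noteq> 0"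
      using half[of p] by (simp_all add: w_def add_eq_0_iff2)
    have "b m (n - 1) - b m n = 1 / (w - 1/2) - 1 / (w + 1/2)"
      by (simp add: b_def w_def p point_def algebra_simps)
    also have "\<dots> = 1 / ((w - 1/2) * (w + 1/2))"
      using ne by (simp add: diff_frac_eq)
    also have "(w - 1/2) * (w + 1/2) = w\<^sup>2 - 1/4"
      by (simp add: power2_eq_square algebra_simps)
    finally show ?thesis
      by (simp add: F_def p w_def)
  qed
  then have "(\<Sum>w\<in>lattice_box \<tau> M N. 1 / w\<^sup>2) = (\<Sum>w\<in>lattice_box \<tau> M N. F w) +
      (\<Sum>(m, n)\<in>int_box M \<times> int_box N. b m (n - 1) - b m n)" for M N
    by (simp add: sum_lattice_box sum.distrib)
  then show ?thesis
    using itlim_add[OF 1 2] by auto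
qed

text \<open>
  The origin may be included because \<open>1 / 0 = 0\<close>.
\<close>

lemma eisenstein_box_sum:
  assumes "k > 0"
  shows "(\<Sum>(m, n)\<in>int_box M \<times> int_box N - {(0, 0)}. 1 / (of_int m * \<tau> + of_int n) ^ k) =
    (\<Sum>w\<in>lattice_box \<tau> M N. 1 / w ^ k)"
proof -
  have "(\<Sum>w\<in>lattice_box \<tau> M N. 1 / w ^ k) = (\<Sum>p\<in>int_box M \<times> int_box N. 1 / point p ^ k)"
    by (rule sum_lattice_box)
  also have "\<dots> = (\<Sum>p\<in>int_box M \<times> int_box N - {(0, 0)}. 1 / point p ^ k)"
    using assms by (intro sum.mono_neutral_right) (auto simp: finite_int_box point_def)
  finally show ?thesis
    by (simp add: point_def case_prod_unfold)
qed

lemma eisenstein_eqI: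
  assumes "k > 0" "itlim (\<lambda>M N. \<Sum>w\<in>lattice_box \<tau> M N. 1 / w ^ k) L"
  shows "eisenstein_G k \<tau> = L"
  unfolding eisenstein_G_def eisenstein_box_sum[OF assms(1)] by (rule itlim_imp_lim[OF assms(2)])

lemma itlim_eisenstein_2: "itlim (\<lambda>M N. \<Sum>w\<in>lattice_box \<tau> M N. 1 / w\<^sup>2) (eisenstein_G 2 \<tau>)"
  using itlim_eisenstein_2_exists eisenstein_eqI[of 2] by auto

lemma has_sum_eisenstein:
  assumes "k \<ge> 3"
  shows "((\<lambda>w. 1 / w ^ k) has_sum eisenstein_G k \<tau>) (\<Lambda> - {0})"
proof -
  have "(\<lambda>w. (-1) ^ k * (1 / (0 - w) ^ k)) summable_on \<Lambda>"
    by (intro summable_on_cmult_right summable_inverse_power assms order_refl)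
  moreover have "(-1) ^ k * (1 / (0 - w) ^ k) = 1 / w ^ k" for w :: complex
    by (cases "even k") auto
  ultimately have "((\<lambda>w. 1 / w ^ k) has_sum (\<Sum>\<^sub>\<infinity>w\<in>\<Lambda>. 1 / w ^ k)) \<Lambda>"
    by simp
  moreover from this have "eisenstein_G k \<tau> = (\<Sum>\<^sub>\<infinity>w\<in>\<Lambda>. 1 / w ^ k)"
    using assms by (intro eisenstein_eqI has_sum_lattice_imp_itlim) auto
  ultimately have "((\<lambda>w. 1 / w ^ k) has_sum eisenstein_G k \<tau>) \<Lambda>"
    by simp
  then show ?thesis
    by (subst has_sum_cong_neutral[where T = \<Lambda> and g = "\<lambda>w. 1 / w ^ k"]) (use assms in auto)
qed

text \<open>
  The terms of \<open>w\<close> and \<open>- w\<close> cancel.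
\<close>

lemma eisenstein_odd:
  assumes "k \<ge> 3" "odd k"
  shows "eisenstein_G k \<tau> = 0"
proof -
  have "((\<lambda>w. 1 / (- w) ^ k) has_sum eisenstein_G k \<tau>) (\<Lambda> - {0})"
    using has_sum_eisenstein[OF assms(1)]
      has_sum_reindex_bij_betw[OF bij_uminus, where f = "\<lambda>w. 1 / w ^ k"] by (simp only:)
  then have "((\<lambda>w. - (1 / w ^ k)) has_sum eisenstein_G k \<tau>) (\<Lambda> - {0})"
    using assms(2) by simp
  moreover have "((\<lambda>w. - (1 / w ^ k)) has_sum - eisenstein_G k \<tau>) (\<Lambda> - {0})"
    using has_sum_eisenstein[OF assms(1)] by (simp only: has_sum_uminus) simp
  ultimately have "eisenstein_G k \<tau> = - eisenstein_G k \<tau>"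
    by (rule has_sum_unique)
  then show ?thesis by simp
qed

end

section \<open>The Weierstrass function\<close>

lemma higher_deriv_inverse_power2:
  fixes w z :: complex
  assumes "z \<noteq> w"
  shows "(deriv ^^ n) (\<lambda>z. 1 / (z - w)\<^sup>2) z = (-1) ^ n * fact (n + 1) / (z - w) ^ (n + 2)"
  using assms
proof (induction n arbitrary: z)
  case 0
  then show ?case by (simp add: power2_eq_square)
next
  case (Suc n)
  have "eventually (\<lambda>u. u \<in> - {w}) (nhds z)"
    using Suc.prems by (intro eventually_nhds_in_open) auto
  then have "eventually (\<lambda>u. (deriv ^^ n) (\<lambda>z. 1 / (z - w)\<^sup>2) u =
      (-1) ^ n * fact (n + 1) / (u - w) ^ (n + 2)) (nhds z)"
    by eventually_elim (use Suc.IH in auto)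
  then have "(deriv ^^ Suc n) (\<lambda>z. 1 / (z - w)\<^sup>2) z =
      deriv (\<lambda>u. (-1) ^ n * fact (n + 1) / (u - w) ^ (n + 2)) z"
    by (simp add: deriv_cong_ev)
  also have "\<dots> = (-1) ^ Suc n * fact (Suc n + 1) / (z - w) ^ (Suc n + 2)"
  proof (rule DERIV_imp_deriv)
    define d where "d = z - w"
    have d: "d \<noteq> 0"
      using Suc.prems by (simp add: d_def)
    have pow: "((\<lambda>u. (u - w) ^ (n + 2)) has_field_derivative of_nat (n + 2) * d ^ (n + 1)) (at z)"
      using DERIV_power[OF DERIV_diff[OF DERIV_ident DERIV_const[of w]], of "n + 2"]
      by (simp add: d_def)
    have "((\<lambda>u. (-1) ^ n * fact (n + 1) / (u - w) ^ (n + 2)) has_field_derivative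
        - ((-1) ^ n * fact (n + 1) * (of_nat (n + 2) * d ^ (n + 1))) / (d ^ (n + 2))\<^sup>2) (at z)"
      using DERIV_divide[OF DERIV_const pow, of "(-1) ^ n * fact (n + 1)"] d
      unfolding d_def[symmetric] by (simp only: power2_eq_square mult_zero_left diff_0) auto
    also have "- ((-1) ^ n * fact (n + 1) * (of_nat (n + 2) * d ^ (n + 1))) / (d ^ (n + 2))\<^sup>2 =
        (-1) ^ Suc n * fact (Suc n + 1) / d ^ (Suc n + 2)"
    proof -
      have "(d ^ (n + 2))\<^sup>2 = d ^ (n + 1) * d ^ (Suc n + 2)"
        by (simp add: power2_eq_square mult_ac)
      moreover have "(fact (Suc n + 1) :: complex) = of_nat (n + 2) * fact (n + 1)"
        by (metis add_2_eq_Suc' add_Suc fact_Suc Suc_eq_plus1)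
      ultimately show ?thesis
        using d by simp
    qed
    finally show "((\<lambda>u. (-1) ^ n * fact (n + 1) / (u - w) ^ (n + 2)) has_field_derivative
        (-1) ^ Suc n * fact (Suc n + 1) / (z - w) ^ (Suc n + 2)) (at z)"
      unfolding d_def .
  qed
  finally show ?case .
qed

lemma higher_deriv_sum:
  fixes f :: "'a \<Rightarrow> complex \<Rightarrow> complex"
  assumes "finite A" "\<And>i. i \<in> A \<Longrightarrow> f i holomorphic_on S" "open S" "z \<in> S"
  shows "(deriv ^^ n) (\<lambda>z. \<Sum>i\<in>A. f i z) z = (\<Sum>i\<in>A. (deriv ^^ n) (f i) z)"
  using assms(1,2)
proof (induction rule: finite_induct)
  case (insert x F)
  then show ?case
    using assms(3,4) by (simp add: higher_deriv_add[of _ S] holomorphic_on_sum)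
qed simp

context half_plane_lattice
begin

text \<open>
  The regular part of \<open>\<wp>\<close> at the origin.
\<close>

definition wp_reg :: "complex \<Rightarrow> complex" where
  "wp_reg z = (\<Sum>\<^sub>\<infinity>w\<in>\<Lambda> - {0}. 1 / (z - w)\<^sup>2 - 1 / w\<^sup>2)"

lemma weierstrass_wp_eq: "weierstrass_wp \<tau> = (\<lambda>z. 1 / z\<^sup>2 + wp_reg z)"
  by (simp add: fun_eq_iff weierstrass_wp_def wp_reg_def)

lemma open_regular_set: "open (- (\<Lambda> - {0}))" "open (- \<Lambda>)"
  by (intro open_Compl closed_sublattice; blast)+

text \<open>
  Lattice points \<open>w\<close> far from \<open>z0\<close> have distance at least \<open>\<bar>w\<bar> / 2\<close> from the points of the ball, and the
  remaining ones have bounded \<open>\<bar>w\<bar>\<close> and positive distance.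
\<close>

lemma lattice_distance:
  assumes "z0 \<notin> \<Lambda> - {0}"
  obtains \<delta> c where "\<delta> > 0" "c > 0" "\<delta> \<le> 1"
    "\<And>z w. z \<in> ball z0 \<delta> \<Longrightarrow> w \<in> \<Lambda> - {0} \<Longrightarrow> norm (z - w) \<ge> c * norm w"
proof -
  obtain e where e: "e > 0" "ball z0 e \<subseteq> - (\<Lambda> - {0})"
    using assms open_regular_set(1) by (meson ComplI openE)
  define \<delta> where "\<delta> = min (e / 2) 1"
  define R where "R = norm z0 + 1"
  define c where "c = min (1 / 2) (\<delta> / (2 * R))"
  have \<delta>: "\<delta> > 0" "\<delta> \<le> 1" "\<delta> \<le> e / 2"
    using e by (auto simp: \<delta>_def)
  have R: "R \<ge> 1"
    by (simp add: R_def)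
  have c: "c > 0" "c \<le> 1 / 2" "c \<le> \<delta> / (2 * R)"
    using \<delta> R by (auto simp: c_def)
  have "norm (z - w) \<ge> c * norm w" if z: "z \<in> ball z0 \<delta>" and w: "w \<in> \<Lambda> - {0}" for z w
  proof (cases "norm w \<ge> 2 * R")
    case True
    have "norm z \<le> R"
      using z \<delta> norm_triangle_ineq2[of z z0] by (simp add: R_def dist_norm norm_minus_commute)
    then have "norm w / 2 \<le> norm (z - w)"
      using True by (intro norm_diff_ge) simp
    moreover have "c * norm w \<le> 1 / 2 * norm w"
      using c by (intro mult_right_mono) auto
    ultimately show ?thesis by simp
  next
    case False
    have "w \<notin> ball z0 e"
      using e w by auto
    then have "e \<le> dist z0 w"
      by simp
    also have "\<dots> \<le> dist z0 z + dist z w"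
      by (rule dist_triangle)
    finally have "\<delta> \<le> norm (z - w)"
      using z \<delta> by (simp add: dist_norm)
    moreover have "c * norm w \<le> \<delta> / (2 * R) * (2 * R)"
      using c False R \<delta> by (intro mult_mono) auto
    ultimately show ?thesis
      using R by simp
  qed
  then show ?thesis
    using that \<delta> c by blast
qed

text \<open>
  The difference is \<open>z (2 w - z) / ((z - w)\<^sup>2 w\<^sup>2)\<close>, where the numerator is of order \<open>\<bar>w\<bar>\<close> and the denominator
  of order \<open>\<bar>w\<bar>\<^sup>4\<close>.
\<close>

lemma wp_term_bound:
  assumes "z0 \<notin> \<Lambda> - {0}"
  obtains \<delta> C where "\<delta> > 0" "ball z0 \<delta> \<subseteq> - (\<Lambda> - {0})"
    "\<And>z w. z \<in> ball z0 \<delta> \<Longrightarrow> w \<in> \<Lambda> - {0} \<Longrightarrow>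
      norm (1 / (z - w)\<^sup>2 - 1 / w\<^sup>2) \<le> C / norm w ^ 3"
proof -
  obtain \<delta> c where \<delta>: "\<delta> > 0" "\<delta> \<le> 1" and c: "c > 0"
    and dist: "\<And>z w. z \<in> ball z0 \<delta> \<Longrightarrow> w \<in> \<Lambda> - {0} \<Longrightarrow> norm (z - w) \<ge> c * norm w"
    using lattice_distance[OF assms] by metis
  \<comment> \<open>nonzero lattice points have norm at least \<open>e\<close>, which absorbs \<open>\<bar>z\<bar>\<close> into a multiple of \<open>\<bar>w\<bar>\<close>\<close>
  obtain e where e: "e > 0" "ball 0 e \<subseteq> - (\<Lambda> - {0})"
    using open_regular_set(1) by (meson ComplI openE DiffD2 singletonI)
  define R where "R = norm z0 + 1"
  have R: "R \<ge> 1"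
    by (simp add: R_def)
  define C where "C = R * (2 + R / e) / c\<^sup>2"
  have "norm (1 / (z - w)\<^sup>2 - 1 / w\<^sup>2) \<le> C / norm w ^ 3"
    if z: "z \<in> ball z0 \<delta>" and w: "w \<in> \<Lambda> - {0}" for z w
  proof -
    have w0: "norm w > 0"
      using w by auto
    have zR: "norm z \<le> R"
      using z \<delta> norm_triangle_ineq2[of z z0] by (simp add: R_def dist_norm norm_minus_commute)
    have "w \<notin> ball 0 e"
      using e w by auto
    then have "e \<le> norm w"
      by simp
    then have "R \<le> R / e * norm w"
      using e R by (simp add: field_simps)
    then have num: "norm (2 * w - z) \<le> (2 + R / e) * norm w"
      using norm_triangle_ineq4[of "2 * w" z] zR by (simp add: norm_mult algebra_simps)
    have den: "c * norm w \<le> norm (z - w)"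
      using dist z w by simp
    have pos: "0 < c * norm w"
      using c w0 by simp
    have "norm (z - w) > 0"
      using den pos by linarith
    then have ne: "z - w \<noteq> 0" "w \<noteq> 0"
      using w0 by auto
    have "1 / (z - w)\<^sup>2 - 1 / w\<^sup>2 = (w\<^sup>2 - (z - w)\<^sup>2) / ((z - w)\<^sup>2 * w\<^sup>2)"
      using ne by (simp add: diff_frac_eq)
    also have "w\<^sup>2 - (z - w)\<^sup>2 = z * (2 * w - z)"
      by (simp add: power2_eq_square algebra_simps)
    finally have "norm (1 / (z - w)\<^sup>2 - 1 / w\<^sup>2) =
        norm z * norm (2 * w - z) / (norm (z - w) ^ 2 * norm w ^ 2)"
      by (simp add: norm_divide norm_mult norm_power)
    also have "\<dots> \<le> R * ((2 + R / e) * norm w) / ((c * norm w) ^ 2 * norm w ^ 2)"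
      using num den pos zR w0 R e c
      by (intro frac_le mult_mono power_mono mult_nonneg_nonneg mult_pos_pos zero_less_power) auto
    also have "\<dots> = C / norm w ^ 3"
      using w0 by (simp add: C_def power2_eq_square power3_eq_cube)
    finally show ?thesis .
  qed
  moreover have "ball z0 \<delta> \<subseteq> - (\<Lambda> - {0})"
  proof
    fix z assume z: "z \<in> ball z0 \<delta>"
    show "z \<in> - (\<Lambda> - {0})"
    proof
      assume "z \<in> \<Lambda> - {0}"
      then show False
        using dist[OF z, of z] mult_pos_pos[OF c, of "norm z"] by simp
    qed
  qed
  ultimately show ?thesis
    using that \<delta> by blast
qed

lemma wp_reg_term_holomorphic:
  "w \<notin> S \<Longrightarrow> (\<lambda>z. 1 / (z - w)\<^sup>2 - 1 / w\<^sup>2) holomorphic_on S"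
  by (intro holomorphic_intros) auto

lemma wp_reg_uniform_limit:
  assumes "z0 \<notin> \<Lambda> - {0}"
  obtains \<delta> where "\<delta> > 0" "ball z0 \<delta> \<subseteq> - (\<Lambda> - {0})"
    "uniform_limit (ball z0 \<delta>) (\<lambda>X z. \<Sum>w\<in>X. 1 / (z - w)\<^sup>2 - 1 / w\<^sup>2) wp_reg
       (finite_subsets_at_top (\<Lambda> - {0}))"
    "\<forall>X\<subseteq>\<Lambda> - {0}. (\<lambda>z. \<Sum>w\<in>X. 1 / (z - w)\<^sup>2 - 1 / w\<^sup>2) holomorphic_on ball z0 \<delta>"
proof -
  obtain \<delta> C where \<delta>: "\<delta> > 0" "ball z0 \<delta> \<subseteq> - (\<Lambda> - {0})" and C:
    "\<And>z w. z \<in> ball z0 \<delta> \<Longrightarrow> w \<in> \<Lambda> - {0} \<Longrightarrow>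
      norm (1 / (z - w)\<^sup>2 - 1 / w\<^sup>2) \<le> C / norm w ^ 3"
    using wp_term_bound[OF assms] by blast
  have "(\<lambda>w. C * (1 / norm w ^ 3)) summable_on \<Lambda> - {0}"
    by (intro summable_on_cmult_right summable_on_subset[OF summable_inverse_cube]) auto
  then have "uniform_limit (ball z0 \<delta>) (\<lambda>X z. \<Sum>w\<in>X. 1 / (z - w)\<^sup>2 - 1 / w\<^sup>2) wp_reg
       (finite_subsets_at_top (\<Lambda> - {0}))"
    unfolding wp_reg_def
    by (intro Weierstrass_m_test_general[where M = "\<lambda>w. C * (1 / norm w ^ 3)"]) (use C in auto)
  moreover have "(\<lambda>z. \<Sum>w\<in>X. 1 / (z - w)\<^sup>2 - 1 / w\<^sup>2) holomorphic_on ball z0 \<delta>"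
    if "X \<subseteq> \<Lambda> - {0}" for X
    using that \<delta>(2) by (intro holomorphic_on_sum wp_reg_term_holomorphic) auto
  ultimately show ?thesis
    using that \<delta> by blast
qed

lemma wp_reg_holomorphic: "wp_reg holomorphic_on - (\<Lambda> - {0})"
proof -
  have "\<exists>f'. (wp_reg has_field_derivative f') (at z0)" if z0: "z0 \<in> - (\<Lambda> - {0})" for z0
  proof -
    obtain \<delta> where \<delta>: "\<delta> > 0" and ul:
      "uniform_limit (ball z0 \<delta>) (\<lambda>X z. \<Sum>w\<in>X. 1 / (z - w)\<^sup>2 - 1 / w\<^sup>2) wp_reg
        (finite_subsets_at_top (\<Lambda> - {0}))" and hol:
      "\<forall>X\<subseteq>\<Lambda> - {0}. (\<lambda>z. \<Sum>w\<in>X. 1 / (z - w)\<^sup>2 - 1 / w\<^sup>2) holomorphic_on ball z0 \<delta>"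
      by (rule wp_reg_uniform_limit[of z0]) (use z0 in auto)
    have sub: "cball z0 (\<delta> / 2) \<subseteq> ball z0 \<delta>"
      using \<delta> by auto
    have "wp_reg holomorphic_on ball z0 (\<delta> / 2)"
    proof (rule holomorphic_uniform_limit)
      show "eventually (\<lambda>X. continuous_on (cball z0 (\<delta> / 2)) (\<lambda>z. \<Sum>w\<in>X. 1 / (z - w)\<^sup>2 - 1 / w\<^sup>2) \<and>
          (\<lambda>z. \<Sum>w\<in>X. 1 / (z - w)\<^sup>2 - 1 / w\<^sup>2) holomorphic_on ball z0 (\<delta> / 2))
          (finite_subsets_at_top (\<Lambda> - {0}))"
      proof (rule eventually_finite_subsets_at_top_weakI)
        fix X assume X: "finite X" "X \<subseteq> \<Lambda> - {0}"
        then have "(\<lambda>z. \<Sum>w\<in>X. 1 / (z - w)\<^sup>2 - 1 / w\<^sup>2) holomorphic_on cball z0 (\<delta> / 2)"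
          using hol holomorphic_on_subset[OF _ sub] by blast
        then show "continuous_on (cball z0 (\<delta> / 2)) (\<lambda>z. \<Sum>w\<in>X. 1 / (z - w)\<^sup>2 - 1 / w\<^sup>2) \<and>
          (\<lambda>z. \<Sum>w\<in>X. 1 / (z - w)\<^sup>2 - 1 / w\<^sup>2) holomorphic_on ball z0 (\<delta> / 2)"
          by (auto intro: holomorphic_on_imp_continuous_on holomorphic_on_subset)
      qed
      show "uniform_limit (cball z0 (\<delta> / 2)) (\<lambda>X z. \<Sum>w\<in>X. 1 / (z - w)\<^sup>2 - 1 / w\<^sup>2) wp_reg
          (finite_subsets_at_top (\<Lambda> - {0}))"
        using ul sub by (rule uniform_limit_on_subset)
    qed auto
    then have "wp_reg field_differentiable at z0"
      using \<delta> by (intro holomorphic_on_imp_differentiable_at[of _ "ball z0 (\<delta> / 2)"]) auto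
    then show ?thesis
      by (simp add: field_differentiable_def)
  qed
  then show ?thesis
    unfolding holomorphic_on_open[OF open_regular_set(1)] by blast
qed

text \<open>
  Locally uniform limits of holomorphic functions may be differentiated term by term. The constant
  \<open>1 / w\<^sup>2\<close> disappears.
\<close>

lemma wp_reg_higher_deriv_has_sum:
  assumes "z \<notin> \<Lambda> - {0}" "n \<ge> 1"
  shows "((\<lambda>w. (-1) ^ n * fact (n + 1) / (z - w) ^ (n + 2)) has_sum (deriv ^^ n) wp_reg z) (\<Lambda> - {0})"
proof -
  obtain \<delta> where \<delta>: "\<delta> > 0" "ball z \<delta> \<subseteq> - (\<Lambda> - {0})" and ul:
    "uniform_limit (ball z \<delta>) (\<lambda>X z. \<Sum>w\<in>X. 1 / (z - w)\<^sup>2 - 1 / w\<^sup>2) wp_reg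
      (finite_subsets_at_top (\<Lambda> - {0}))" and hol:
    "\<forall>X\<subseteq>\<Lambda> - {0}. (\<lambda>z. \<Sum>w\<in>X. 1 / (z - w)\<^sup>2 - 1 / w\<^sup>2) holomorphic_on ball z \<delta>"
    by (rule wp_reg_uniform_limit[OF assms(1)])
  have lim: "((\<lambda>X. (deriv ^^ n) (\<lambda>z. \<Sum>w\<in>X. 1 / (z - w)\<^sup>2 - 1 / w\<^sup>2) z) \<longlongrightarrow> (deriv ^^ n) wp_reg z)
      (finite_subsets_at_top (\<Lambda> - {0}))"
    by (rule higher_deriv_complex_uniform_limit[OF ul])
       (use \<delta>(1) hol in \<open>auto intro: eventually_finite_subsets_at_top_weakI\<close>)
  have eq: "(deriv ^^ n) (\<lambda>z. \<Sum>w\<in>X. 1 / (z - w)\<^sup>2 - 1 / w\<^sup>2) z =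
      (\<Sum>w\<in>X. (-1) ^ n * fact (n + 1) / (z - w) ^ (n + 2))"
    if X: "finite X" "X \<subseteq> \<Lambda> - {0}" for X
  proof -
    have "(deriv ^^ n) (\<lambda>z. \<Sum>w\<in>X. 1 / (z - w)\<^sup>2 - 1 / w\<^sup>2) z =
        (\<Sum>w\<in>X. (deriv ^^ n) (\<lambda>z. 1 / (z - w)\<^sup>2 - 1 / w\<^sup>2) z)"
      by (rule higher_deriv_sum[where S = "ball z \<delta>"])
         (use X \<delta> in \<open>auto intro!: wp_reg_term_holomorphic\<close>)
    also have "\<dots> = (\<Sum>w\<in>X. (-1) ^ n * fact (n + 1) / (z - w) ^ (n + 2))"
    proof (intro sum.cong refl)
      fix w assume w: "w \<in> X"
      have nw: "w \<notin> ball z \<delta>"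
        using X \<delta> w by auto
      have "(deriv ^^ n) (\<lambda>z. 1 / (z - w)\<^sup>2 - 1 / w\<^sup>2) z =
          (deriv ^^ n) (\<lambda>z. 1 / (z - w)\<^sup>2) z - (deriv ^^ n) (\<lambda>z. 1 / w\<^sup>2) z"
        by (rule higher_deriv_diff[where S = "ball z \<delta>"])
           (use \<delta>(1) nw in \<open>auto intro!: holomorphic_intros\<close>)
      then show "(deriv ^^ n) (\<lambda>z. 1 / (z - w)\<^sup>2 - 1 / w\<^sup>2) z =
          (-1) ^ n * fact (n + 1) / (z - w) ^ (n + 2)"
        using assms(2) nw \<delta>(1) by (subst (asm) higher_deriv_inverse_power2) auto
    qed
    finally show ?thesis .
  qed
  show ?thesis
    unfolding has_sum_def
    by (rule Lim_transform_eventually[OF lim])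
       (intro eventually_finite_subsets_at_top_weakI, rule eq)
qed

lemma wp_holomorphic: "weierstrass_wp \<tau> holomorphic_on - \<Lambda>"
  unfolding weierstrass_wp_eq
  by (intro holomorphic_intros holomorphic_on_subset[OF wp_reg_holomorphic]) auto

lemma wp_higher_deriv:
  assumes "z \<notin> \<Lambda>"
  shows "(deriv ^^ n) (weierstrass_wp \<tau>) z = (-1) ^ n * fact (n + 1) / z ^ (n + 2) + (deriv ^^ n) wp_reg z"
proof -
  have "z \<noteq> 0"
    using assms by auto
  have "(deriv ^^ n) (weierstrass_wp \<tau>) z = (deriv ^^ n) (\<lambda>z. 1 / (z - 0)\<^sup>2) z + (deriv ^^ n) wp_reg z"
    unfolding weierstrass_wp_eq diff_zero
    by (rule higher_deriv_add[where S = "- \<Lambda>"])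
       (use assms in \<open>auto intro!: holomorphic_intros holomorphic_on_subset[OF wp_reg_holomorphic] open_regular_set\<close>)
  then show ?thesis
    using \<open>z \<noteq> 0\<close> by (subst (asm) higher_deriv_inverse_power2) auto
qed

lemma wp_higher_deriv_has_sum:
  assumes "z \<notin> \<Lambda>" "n \<ge> 1"
  shows "((\<lambda>w. (-1) ^ n * fact (n + 1) / (z - w) ^ (n + 2)) has_sum (deriv ^^ n) (weierstrass_wp \<tau>) z) \<Lambda>"
proof -
  have "((\<lambda>w. (-1) ^ n * fact (n + 1) / (z - w) ^ (n + 2)) has_sum
      (-1) ^ n * fact (n + 1) / (z - 0) ^ (n + 2) + (deriv ^^ n) wp_reg z) (insert 0 (\<Lambda> - {0}))"
    using assms by (intro has_sum_insert wp_reg_higher_deriv_has_sum) auto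
  then show ?thesis
    by (simp add: wp_higher_deriv[OF assms(1)] insert_absorb)
qed

lemma wp_reg_has_sum:
  assumes "z \<notin> \<Lambda> - {0}"
  shows "((\<lambda>w. 1 / (z - w)\<^sup>2 - 1 / w\<^sup>2) has_sum wp_reg z) (\<Lambda> - {0})"
proof -
  obtain \<delta> where "\<delta> > 0" and ul:
    "uniform_limit (ball z \<delta>) (\<lambda>X z. \<Sum>w\<in>X. 1 / (z - w)\<^sup>2 - 1 / w\<^sup>2) wp_reg
      (finite_subsets_at_top (\<Lambda> - {0}))"
    by (rule wp_reg_uniform_limit[OF assms(1)])
  then show ?thesis
    unfolding has_sum_def by (intro tendsto_uniform_limitI[OF ul]) auto
qed

text \<open>
  The term of the origin is \<open>1 / z\<^sup>2\<close>, because \<open>1 / 0 = 0\<close>.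
\<close>

lemma wp_has_sum:
  assumes "z \<notin> \<Lambda>"
  shows "((\<lambda>w. 1 / (z - w)\<^sup>2 - 1 / w\<^sup>2) has_sum weierstrass_wp \<tau> z) \<Lambda>"
proof -
  have "((\<lambda>w. 1 / (z - w)\<^sup>2 - 1 / w\<^sup>2) has_sum (1 / (z - 0)\<^sup>2 - 1 / 0\<^sup>2) + wp_reg z) (insert 0 (\<Lambda> - {0}))"
    using assms by (intro has_sum_insert wp_reg_has_sum) auto
  then show ?thesis
    by (simp add: weierstrass_wp_eq insert_absorb)
qed

lemma wp_difference_has_sum:
  assumes "z \<notin> \<Lambda>" "\<omega> \<in> \<Lambda>"
  shows "((\<lambda>p. 1 / (z + \<omega> - point p)\<^sup>2 - 1 / (z - point p)\<^sup>2) has_sum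
    weierstrass_wp \<tau> (z + \<omega>) - weierstrass_wp \<tau> z) UNIV"
proof -
  have "((\<lambda>w. (1 / (z + \<omega> - w)\<^sup>2 - 1 / w\<^sup>2) + - (1 / (z - w)\<^sup>2 - 1 / w\<^sup>2)) has_sum
      weierstrass_wp \<tau> (z + \<omega>) + - weierstrass_wp \<tau> z) \<Lambda>"
    using assms by (intro has_sum_add has_sum_uminusI wp_has_sum) (auto simp: add_mem_iff)
  then show ?thesis
    unfolding range_point has_sum_reindex[OF inj_point] by (simp add: o_def)
qed

text \<open>
  The difference \<open>\<wp> (z + 1) - \<wp> z\<close> is an absolutely convergent series that telescopes along the rows
  \<open>m \<tau> + \<int>\<close>.
\<close>

lemma wp_plus_1:
  assumes "z \<notin> \<Lambda>"
  shows "weierstrass_wp \<tau> (z + 1) = weierstrass_wp \<tau> z"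
proof -
  define b where "b m n = 1 / ((z - of_int m * \<tau>) + of_int n * (- 1)) ^ 2" for m n
  have "((\<lambda>(m, n). b m (n - 1) - b m n) has_sum weierstrass_wp \<tau> (z + 1) - weierstrass_wp \<tau> z) UNIV"
    using wp_difference_has_sum[OF assms one_mem]
    by (simp add: b_def point_def case_prod_unfold algebra_simps)
  moreover have "(\<lambda>N. b m (int N)) \<longlonglongrightarrow> 0" "(\<lambda>N. b m (- int N)) \<longlonglongrightarrow> 0" for m
    unfolding b_def by (intro inverse_power_progression_tendsto_0; simp)+
  ultimately have "weierstrass_wp \<tau> (z + 1) - weierstrass_wp \<tau> z = 0"
    by (intro telescoping_has_sum) auto
  then show ?thesis by simp
qed

text \<open>
  The same telescoping along the columns \<open>\<int> \<tau> + n\<close>.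
\<close>

lemma wp_plus_tau:
  assumes "z \<notin> \<Lambda>"
  shows "weierstrass_wp \<tau> (z + \<tau>) = weierstrass_wp \<tau> z"
proof -
  define b where "b n m = 1 / ((z - of_int n) + of_int m * (- \<tau>)) ^ 2" for m n
  have "((\<lambda>(m, n). b n (m - 1) - b n m) has_sum weierstrass_wp \<tau> (z + \<tau>) - weierstrass_wp \<tau> z) (UNIV \<times> UNIV)"
    using wp_difference_has_sum[OF assms tau_mem]
    by (simp add: b_def point_def case_prod_unfold algebra_simps)
  then have "((\<lambda>(n, m). b n (m - 1) - b n m) has_sum weierstrass_wp \<tau> (z + \<tau>) - weierstrass_wp \<tau> z) UNIV"
    by (subst (asm) has_sum_swap) simp
  moreover have "(\<lambda>N. b n (int N)) \<longlonglongrightarrow> 0" "(\<lambda>N. b n (- int N)) \<longlonglongrightarrow> 0" for n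
    unfolding b_def using Im_pos by (intro inverse_power_progression_tendsto_0; force)+
  ultimately have "weierstrass_wp \<tau> (z + \<tau>) - weierstrass_wp \<tau> z = 0"
    by (intro telescoping_has_sum) auto
  then show ?thesis by simp
qed

end

section \<open>Elliptic functions without poles\<close>

context half_plane_lattice
begin

lemma of_int_mult_mem: "\<omega> \<in> \<Lambda> \<Longrightarrow> of_int k * \<omega> \<in> \<Lambda>"
proof -
  assume "\<omega> \<in> \<Lambda>"
  then obtain m n where "\<omega> = of_int m * \<tau> + of_int n"
    by (auto simp: period_lattice_def)
  then have "of_int k * \<omega> = of_int (k * m) * \<tau> + of_int (k * n)"
    by (simp add: algebra_simps)
  then show ?thesis
    unfolding period_lattice_def by blast
qed

lemma multiple_period:
  assumes per: "\<And>z. z \<notin> \<Lambda> \<Longrightarrow> f (z + \<omega>) = f z" and \<omega>: "\<omega> \<in> \<Lambda>" and z: "z \<notin> \<Lambda>"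
  shows "f (z + of_int k * \<omega>) = f z"
proof -
  have nat: "f (z + of_nat n * \<omega>) = f z" if "z \<notin> \<Lambda>" for n z
  proof (induction n)
    case (Suc n)
    have "z + of_int (int n) * \<omega> \<notin> \<Lambda>"
      using that add_mem_iff[OF of_int_mult_mem[OF \<omega>]] by blast
    from per[OF this] Suc.IH show ?case
      by (simp add: algebra_simps)
  qed simp
  show ?thesis
  proof (cases k)
    case (nonneg n)
    then show ?thesis
      using nat[OF z] by simp
  next
    case (neg n)
    have "z + of_int k * \<omega> \<notin> \<Lambda>"
      using z add_mem_iff[OF of_int_mult_mem[OF \<omega>]] by blast
    from nat[OF this, of "Suc n"] show ?thesis
      by (simp add: neg algebra_simps)
  qed
qed

lemma lattice_period:
  assumes "\<And>z. z \<notin> \<Lambda> \<Longrightarrow> f (z + 1) = f z" "\<And>z. z \<notin> \<Lambda> \<Longrightarrow> f (z + \<tau>) = f z"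
    and "\<omega> \<in> \<Lambda>" "z \<notin> \<Lambda>"
  shows "f (z + \<omega>) = f z"
proof -
  obtain m n where \<omega>: "\<omega> = of_int m * \<tau> + of_int n"
    using assms(3) by (auto simp: period_lattice_def)
  have "z + of_int m * \<tau> \<notin> \<Lambda>"
    using assms(4) add_mem_iff[OF of_int_mult_mem[OF tau_mem]] by blast
  then have "f ((z + of_int m * \<tau>) + of_int n * 1) = f (z + of_int m * \<tau>)"
    by (intro multiple_period assms(1)) auto
  also have "\<dots> = f z"
    by (intro multiple_period assms(2,4)) auto
  finally show ?thesis
    by (simp add: \<omega> algebra_simps)
qed

lemma reduce_to_parallelogram:
  obtains \<omega> s t where "\<omega> \<in> \<Lambda>" "s \<in> {0..1::real}" "t \<in> {0..1::real}"
    "z = of_real s * \<tau> + of_real t + \<omega>"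
proof -
  define a where "a = Im z / Im \<tau>"
  define b where "b = Re z - a * Re \<tau>"
  have z: "z = of_real a * \<tau> + of_real b"
    using Im_pos by (simp add: complex_eq_iff a_def b_def)
  show ?thesis
  proof (rule that)
    show "of_int \<lfloor>a\<rfloor> * \<tau> + of_int \<lfloor>b\<rfloor> \<in> \<Lambda>"
      by (auto simp: period_lattice_def)
    show "frac a \<in> {0..1}" "frac b \<in> {0..1}"
      by (simp_all add: less_imp_le[OF frac_lt_1])
    show "z = of_real (frac a) * \<tau> + of_real (frac b) + (of_int \<lfloor>a\<rfloor> * \<tau> + of_int \<lfloor>b\<rfloor>)"
      by (simp add: z frac_def algebra_simps)
  qed
qed

lemma eventually_not_in_lattice: "eventually (\<lambda>z. z \<notin> \<Lambda>) (at \<omega>)"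
proof -
  have "eventually (\<lambda>z. z \<in> - (\<Lambda> - {\<omega>})) (nhds \<omega>)"
    by (intro eventually_nhds_in_open open_Compl closed_sublattice) auto
  then show ?thesis
    by (auto simp: eventually_at_filter elim: eventually_mono)
qed

text \<open>
  By periodicity \<open>f\<close> tends to \<open>0\<close> at every lattice point, so it extends to an entire function by
  Riemann's theorem on removable singularities. The extension is bounded by its values on a period
  parallelogram, hence constant by Liouville's theorem, and its value at the origin is \<open>0\<close>.
\<close>

lemma elliptic_vanishing:
  assumes hol: "f holomorphic_on - \<Lambda>"
    and per: "\<And>z. z \<notin> \<Lambda> \<Longrightarrow> f (z + 1) = f z" "\<And>z. z \<notin> \<Lambda> \<Longrightarrow> f (z + \<tau>) = f z"
    and lim: "(f \<longlongrightarrow> 0) (at 0)"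
    and z: "z \<notin> \<Lambda>"
  shows "f z = 0"
proof -
  define g where "g = (\<lambda>z. if z \<in> \<Lambda> then 0 else f z)"
  have g_period: "g (z + \<omega>) = g z" if "\<omega> \<in> \<Lambda>" for z \<omega>
    using that lattice_period[of f \<omega> z, OF per that] by (auto simp: g_def add_mem_iff)
  have g_lim0: "(g \<longlongrightarrow> 0) (at 0)"
    by (rule Lim_transform_eventually[OF lim])
       (use eventually_not_in_lattice[of 0] in \<open>auto simp: g_def elim: eventually_mono\<close>)
  have g_lim: "(g \<longlongrightarrow> g \<omega>) (at \<omega>)" if "\<omega> \<in> \<Lambda>" for \<omega>
  proof -
    have "((\<lambda>h. g (h + \<omega>)) \<longlongrightarrow> 0) (at 0)"
      using g_lim0 g_period[OF that] by simp
    then have "(g \<longlongrightarrow> 0) (at \<omega>)"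
      using LIM_offset_zero_cancel[of g \<omega> 0] by (simp add: add.commute)
    then show ?thesis
      using that by (simp add: g_def)
  qed
  have g_hol: "g holomorphic_on - \<Lambda>"
    by (rule holomorphic_transform[OF hol]) (simp add: g_def)
  have "g field_differentiable at \<omega>" for \<omega>
  proof (cases "\<omega> \<in> \<Lambda>")
    case True
    define U where "U = - (\<Lambda> - {\<omega>})"
    have "open U"
      unfolding U_def by (intro open_Compl closed_sublattice) auto
    then have U: "open U" "\<omega> \<in> U"
      by (auto simp: U_def)
    have "g holomorphic_on U"
    proof (rule no_isolated_singularity'[where K = "{\<omega>}"])
      show "g holomorphic_on U - {\<omega>}"
        by (rule holomorphic_on_subset[OF g_hol]) (use True in \<open>auto simp: U_def\<close>)
      show "(g \<longlongrightarrow> g u) (at u within U)" if "u \<in> {\<omega>}" for u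
        using g_lim[OF True] that by (auto intro: tendsto_within_subset)
    qed (use U in auto)
    then show ?thesis
      using U by (rule holomorphic_on_imp_differentiable_at)
  next
    case False
    then show ?thesis
      using g_hol open_regular_set(2) by (intro holomorphic_on_imp_differentiable_at[of g "- \<Lambda>"]) auto
  qed
  then have entire: "g holomorphic_on UNIV"
    by (simp add: holomorphic_on_def field_differentiable_at_within)
  have "compact ((\<lambda>(s, t). of_real s * \<tau> + of_real t) ` ({0..1::real} \<times> {0..1::real}))"
    by (intro compact_continuous_image compact_Times) (auto simp: case_prod_unfold intro!: continuous_intros)
  then have "compact (g ` (\<lambda>(s, t). of_real s * \<tau> + of_real t) ` ({0..1::real} \<times> {0..1::real}))"
    by (rule compact_continuous_image[OF
          continuous_on_subset[OF holomorphic_on_imp_continuous_on[OF entire] subset_UNIV]])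
  moreover have "range g \<subseteq> g ` (\<lambda>(s, t). of_real s * \<tau> + of_real t) ` ({0..1::real} \<times> {0..1::real})"
  proof
    fix y assume "y \<in> range g"
    then obtain u where y: "y = g u" by auto
    obtain \<omega> s t where u: "\<omega> \<in> \<Lambda>" "s \<in> {0..1::real}" "t \<in> {0..1::real}"
      "u = of_real s * \<tau> + of_real t + \<omega>"
      by (rule reduce_to_parallelogram[of u])
    then have "y = g (of_real s * \<tau> + of_real t)"
      using y g_period by simp
    then show "y \<in> g ` (\<lambda>(s, t). of_real s * \<tau> + of_real t) ` ({0..1::real} \<times> {0..1::real})"
      using u by (intro image_eqI[of _ _ "of_real s * \<tau> + of_real t"] image_eqI[of _ _ "(s, t)"]) auto
  qed
  ultimately have "bounded (range g)"
    by (meson bounded_subset compact_imp_bounded)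
  then have "g constant_on UNIV"
    by (rule Liouville_theorem[OF entire])
  then have "g z = g 0"
    by (metis UNIV_I constant_on_def)
  then show ?thesis
    using z by (simp add: g_def)
qed

end

section \<open>Laurent expansions at the origin\<close>

lemma taylor_remainder_limit:
  fixes f :: "complex \<Rightarrow> complex"
  assumes "f holomorphic_on A" "open A" "0 \<in> A"
  shows "((\<lambda>z. (f z - (\<Sum>i<n. (deriv ^^ i) f 0 / fact i * z ^ i)) / z ^ n) \<longlongrightarrow>
    (deriv ^^ n) f 0 / fact n) (at 0)"
proof -
  define F where "F = fps_expansion f 0"
  define p where "p = (\<lambda>z. \<Sum>i<n. fps_nth F i * z ^ i)"
  define P where "P = (\<Sum>i<n. fps_const (fps_nth F i) * fps_X ^ i)"
  have nth: "fps_nth F i = (deriv ^^ i) f 0 / fact i" for i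
    by (simp add: F_def fps_expansion_def)
  have "f has_fps_expansion F"
    unfolding F_def using assms by blast
  moreover have "p has_fps_expansion P"
    unfolding p_def P_def by (intro fps_expansion_intros)
  ultimately have exp: "(\<lambda>z. f z - p z) has_fps_expansion (F - P)"
    by (intro fps_expansion_intros)
  have P_nth: "fps_nth P i = (if i < n then fps_nth F i else 0)" for i
    by (simp add: P_def fps_sum_nth if_distrib[of "\<lambda>x. _ * x"] sum.delta cong: if_cong)
  have sub: "F - P = 0 \<or> n \<le> subdegree (F - P)"
    by (metis P_nth fps_sub_nth diff_self not_le nth_subdegree_nonzero)
  show ?thesis
  proof (cases "F - P = 0")
    case True
    have "eventually (\<lambda>z. f z - p z = 0) (nhds 0)"
      using exp unfolding True has_fps_expansion_def by (auto elim: eventually_mono)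
    then have "eventually (\<lambda>z. (f z - p z) / z ^ n = 0) (at 0)"
      by (auto simp: eventually_at_filter elim: eventually_mono)
    then have "((\<lambda>z. (f z - p z) / z ^ n) \<longlongrightarrow> 0) (at 0)"
      by (rule tendsto_eventually)
    moreover have "fps_nth F n = 0"
      using arg_cong[OF True, of "\<lambda>F. fps_nth F n"] by (simp add: P_nth)
    ultimately show ?thesis
      by (simp add: p_def nth)
  next
    case False
    have "(\<lambda>z. if z = 0 then fps_nth (F - P) n else (f z - p z) / z ^ n) has_fps_expansion
        fps_shift n (F - P)"
      using sub False by (intro has_fps_expansion_shift[OF exp]) auto
    then have "isCont (\<lambda>z. if z = 0 then fps_nth (F - P) n else (f z - p z) / z ^ n) 0"
      by (rule has_fps_expansion_imp_continuous)
    then have "((\<lambda>z. if z = 0 then fps_nth (F - P) n else (f z - p z) / z ^ n) \<longlongrightarrow> fps_nth F n) (at 0)"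
      by (simp add: isCont_def P_nth)
    then have "((\<lambda>z. (f z - p z) / z ^ n) \<longlongrightarrow> fps_nth F n) (at 0)"
      by (rule Lim_transform_eventually) (auto simp: eventually_at_filter)
    then show ?thesis
      by (simp add: p_def nth)
  qed
qed

context half_plane_lattice
begin

lemma wp_reg_0: "wp_reg 0 = 0"
  by (simp add: wp_reg_def)

text \<open>
  The Taylor coefficients of the regular part: \<open>\<wp> z = 1 / z\<^sup>2 + (\<Sum>n\<ge>1. (n + 1) G\<^bsub>n+2\<^esub> z\<^sup>n)\<close>, where the odd
  coefficients are zero.
\<close>

lemma wp_reg_higher_deriv_0:
  assumes "n \<ge> 1"
  shows "(deriv ^^ n) wp_reg 0 = fact (n + 1) * eisenstein_G (n + 2) \<tau>"
proof -
  have "((\<lambda>w. (-1) ^ n * fact (n + 1) / (0 - w) ^ (n + 2)) has_sum (deriv ^^ n) wp_reg 0) (\<Lambda> - {0})"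
    using assms by (intro wp_reg_higher_deriv_has_sum) auto
  moreover have "(-1) ^ n * fact (n + 1) / (0 - w) ^ (n + 2) = fact (n + 1) * (1 / w ^ (n + 2))" for w :: complex
    by (cases "even n") auto
  moreover have "((\<lambda>w. fact (n + 1) * (1 / w ^ (n + 2))) has_sum
      fact (n + 1) * eisenstein_G (n + 2) \<tau>) (\<Lambda> - {0})"
    using assms by (intro has_sum_cmult_right has_sum_eisenstein) auto
  ultimately show ?thesis
    using has_sum_unique by fastforce
qed

lemma wp_reg_higher_deriv_0_odd: "odd n \<Longrightarrow> (deriv ^^ n) wp_reg 0 = 0"
  using wp_reg_higher_deriv_0[of n] eisenstein_odd[of "n + 2"] by (cases n) auto

end

section \<open>The recursion for the even derivatives of the Weierstrass function\<close>

context half_plane_lattice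
begin

text \<open>
  The constant term at the origin of \<open>\<wp>\<close> for \<open>m = 1\<close> and of \<open>\<wp>\<^bsub>2m\<^esub>\<close> for \<open>m \<ge> 2\<close>. In the first case it is \<open>0\<close>,
  not \<open>G\<^sub>2\<close>, because \<open>\<wp>\<close> is already \<open>\<wp>\<^sub>2 - G\<^sub>2\<close>.
\<close>

definition constant_term :: "nat \<Rightarrow> complex" where
  "constant_term m = (if m = 1 then 0 else eisenstein_G (2 * m) \<tau>)"

text \<open>
  This is \<open>\<wp>\<^bsub>2m\<^esub> - G\<^bsub>2m\<^esub>\<close> for every \<open>m \<ge> 1\<close>, written so that the conditionally convergent series
  \<open>\<wp>\<^sub>2\<close> and \<open>G\<^sub>2\<close> do not occur.
\<close>

definition wp_centered :: "nat \<Rightarrow> complex \<Rightarrow> complex" where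
  "wp_centered m z = (deriv ^^ (2 * m - 2)) (weierstrass_wp \<tau>) z / fact (2 * m - 1) - constant_term m"

definition wp_centered_reg :: "nat \<Rightarrow> complex \<Rightarrow> complex" where
  "wp_centered_reg m z = (deriv ^^ (2 * m - 2)) wp_reg z / fact (2 * m - 1) - constant_term m"

lemma wp_centered_1: "wp_centered 1 = weierstrass_wp \<tau>"
  by (simp add: fun_eq_iff wp_centered_def constant_term_def)

lemma wp_centered_eq:
  assumes "z \<notin> \<Lambda>" "m \<ge> 1"
  shows "wp_centered m z = 1 / z ^ (2 * m) + wp_centered_reg m z"
proof -
  have e: "2 * m - 2 + 1 = 2 * m - 1" "2 * m - 2 + 2 = 2 * m"
    using assms(2) by auto
  have "even (2 * m - 2)"
    by simp
  then show ?thesis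
    using wp_higher_deriv[OF assms(1), of "2 * m - 2"]
    unfolding e by (simp add: wp_centered_def wp_centered_reg_def add_divide_distrib)
qed

lemma wp_centered_holomorphic: "wp_centered m holomorphic_on - \<Lambda>"
  unfolding wp_centered_def[abs_def]
  by (intro holomorphic_intros wp_holomorphic open_regular_set) auto

lemma wp_centered_reg_holomorphic: "wp_centered_reg m holomorphic_on - (\<Lambda> - {0})"
  unfolding wp_centered_reg_def[abs_def]
  by (intro holomorphic_intros wp_reg_holomorphic open_regular_set) auto

lemma inverse_power_has_sum:
  assumes "z \<notin> \<Lambda>" "m \<ge> 2"
  shows "((\<lambda>w. 1 / (z - w) ^ (2 * m)) has_sum wp_centered m z + eisenstein_G (2 * m) \<tau>) \<Lambda>"
proof -
  have e: "2 * m - 2 + 1 = 2 * m - 1" "2 * m - 2 + 2 = 2 * m"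
    using assms(2) by auto
  have "even (2 * m - 2)"
    by simp
  moreover have "((\<lambda>w. (-1) ^ (2 * m - 2) * fact (2 * m - 2 + 1) / (z - w) ^ (2 * m - 2 + 2) / fact (2 * m - 1)) has_sum
      (deriv ^^ (2 * m - 2)) (weierstrass_wp \<tau>) z / fact (2 * m - 1)) \<Lambda>"
    using assms by (intro has_sum_divide_const wp_higher_deriv_has_sum) auto
  ultimately show ?thesis
    using assms(2) unfolding e by (simp add: wp_centered_def constant_term_def)
qed

lemma wp_centered_period:
  assumes "z \<notin> \<Lambda>" "m \<ge> 1" "\<omega> \<in> {1, \<tau>}"
  shows "wp_centered m (z + \<omega>) = wp_centered m z"
proof (cases "m = 1")
  case True
  then show ?thesis
    using assms wp_plus_1 wp_plus_tau by (auto simp: wp_centered_1[unfolded One_nat_def])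
next
  case False
  with assms have m: "m \<ge> 2" and \<omega>: "\<omega> \<in> \<Lambda>"
    by auto
  have "((\<lambda>w. 1 / (z + \<omega> - w) ^ (2 * m)) has_sum wp_centered m (z + \<omega>) + eisenstein_G (2 * m) \<tau>) \<Lambda>"
    using assms \<omega> m by (intro inverse_power_has_sum) (auto simp: add_mem_iff)
  then have "((\<lambda>w. 1 / (z + \<omega> - (w + \<omega>)) ^ (2 * m)) has_sum
      wp_centered m (z + \<omega>) + eisenstein_G (2 * m) \<tau>) \<Lambda>"
    by (simp only: has_sum_reindex_bij_betw[OF bij_add[OF \<omega>], where f = "\<lambda>w. 1 / (z + \<omega> - w) ^ (2 * m)"])
  then have "((\<lambda>w. 1 / (z - w) ^ (2 * m)) has_sum wp_centered m (z + \<omega>) + eisenstein_G (2 * m) \<tau>) \<Lambda>"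
    by simp
  from has_sum_unique[OF this inverse_power_has_sum[OF assms(1) m]] show ?thesis
    by simp
qed

lemma wp_centered_reg_higher_deriv_0:
  assumes "n \<ge> 1"
  shows "(deriv ^^ n) (wp_centered_reg m) 0 = (deriv ^^ (n + (2 * m - 2))) wp_reg 0 / fact (2 * m - 1)"
proof -
  have hol: "(deriv ^^ (2 * m - 2)) wp_reg holomorphic_on - (\<Lambda> - {0})"
    by (intro holomorphic_intros wp_reg_holomorphic open_regular_set)
  have fun_eq: "wp_centered_reg m = (\<lambda>z. 1 / fact (2 * m - 1) * (deriv ^^ (2 * m - 2)) wp_reg z - constant_term m)"
    by (simp add: fun_eq_iff wp_centered_reg_def)
  have "(deriv ^^ n) (wp_centered_reg m) 0 =
      (deriv ^^ n) (\<lambda>z. 1 / fact (2 * m - 1) * (deriv ^^ (2 * m - 2)) wp_reg z) 0 - (deriv ^^ n) (\<lambda>z. constant_term m) 0"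
    unfolding fun_eq
    by (rule higher_deriv_diff[where S = "- (\<Lambda> - {0})"])
       (use hol open_regular_set(1) in \<open>auto intro!: holomorphic_intros\<close>)
  also have "(deriv ^^ n) (\<lambda>z. 1 / fact (2 * m - 1) * (deriv ^^ (2 * m - 2)) wp_reg z) 0 =
      1 / fact (2 * m - 1) * (deriv ^^ n) ((deriv ^^ (2 * m - 2)) wp_reg) 0"
    by (rule higher_deriv_cmult[OF hol _ open_regular_set(1)]) simp
  also have "(deriv ^^ n) ((deriv ^^ (2 * m - 2)) wp_reg) = (deriv ^^ (n + (2 * m - 2))) wp_reg"
    by (simp add: funpow_add)
  finally show ?thesis
    using assms by simp
qed

lemma wp_centered_reg_0:
  assumes "m \<ge> 1"
  shows "wp_centered_reg m 0 = 0"
proof (cases "m = 1")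
  case True
  then show ?thesis
    by (simp add: wp_centered_reg_def constant_term_def wp_reg_0)
next
  case False
  then have "2 * m - 2 \<ge> 1" and e: "2 * m - 2 + 1 = 2 * m - 1" "2 * m - 2 + 2 = 2 * m"
    using assms by auto
  from wp_reg_higher_deriv_0[OF this(1)] show ?thesis
    unfolding e using False by (simp add: wp_centered_reg_def constant_term_def)
qed

text \<open>
  The constant term has been subtracted and the coefficient of \<open>z\<close> is an odd derivative of
  \<^const>\<open>wp_reg\<close>, which is \<open>0\<close> at the origin, so the expansion starts with \<open>z\<^sup>2\<close>. Its coefficient is
  \<open>(2m + 1)! G\<^bsub>2m+2\<^esub> / (2 (2m - 1)!)\<close>.
\<close>

lemma wp_centered_reg_limits:
  assumes "m \<ge> 1"
  shows "(wp_centered_reg m \<longlongrightarrow> 0) (at 0)"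
    and "((\<lambda>z. wp_centered_reg m z / z\<^sup>2) \<longlongrightarrow> of_nat m * of_nat (2 * m + 1) * eisenstein_G (2 * m + 2) \<tau>) (at 0)"
proof -
  obtain l where m: "m = Suc l"
    using assms by (cases m) auto
  note lim = taylor_remainder_limit[OF wp_centered_reg_holomorphic open_regular_set(1), of m]
  show "(wp_centered_reg m \<longlongrightarrow> 0) (at 0)"
    using lim[of 0] by (simp add: wp_centered_reg_0[OF assms])
  have d1: "(deriv ^^ 1) (wp_centered_reg m) 0 = 0"
    unfolding wp_centered_reg_higher_deriv_0[OF order_refl]
    by (subst wp_reg_higher_deriv_0_odd) (auto simp: m)
  have "(deriv ^^ 2) (wp_centered_reg m) 0 = fact (2 * m + 1) * eisenstein_G (2 * m + 2) \<tau> / fact (2 * m - 1)"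
    using wp_reg_higher_deriv_0[of "2 * m"] by (subst wp_centered_reg_higher_deriv_0) (auto simp: m)
  also have "fact (2 * m + 1) = (of_nat (2 * m + 1) * of_nat (2 * m) * fact (2 * m - 1) :: complex)"
    by (simp add: m algebra_simps)
  finally have d2: "(deriv ^^ 2) (wp_centered_reg m) 0 / 2 =
      of_nat m * of_nat (2 * m + 1) * eisenstein_G (2 * m + 2) \<tau>"
    by simp
  have "(\<Sum>i<2. (deriv ^^ i) (wp_centered_reg m) 0 / fact i * z ^ i) = 0" for z
    using d1 by (simp add: numeral_2_eq_2 wp_centered_reg_0[OF assms])
  then show "((\<lambda>z. wp_centered_reg m z / z\<^sup>2) \<longlongrightarrow>
      of_nat m * of_nat (2 * m + 1) * eisenstein_G (2 * m + 2) \<tau>) (at 0)"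
    using lim[of 2] d2 by simp
qed

text \<open>
  Only the Taylor coefficients with index \<open>i = 2j - 2\<close>, \<open>j \<ge> 2\<close>, are nonzero.
\<close>

lemma wp_reg_taylor_limit:
  assumes "k \<ge> 2"
  shows "((\<lambda>z. (wp_reg z - (\<Sum>j=2..<k. of_nat (2 * j - 1) * eisenstein_G (2 * j) \<tau> * z ^ (2 * j - 2))) /
    z ^ (2 * k - 2)) \<longlongrightarrow> of_nat (2 * k - 1) * eisenstein_G (2 * k) \<tau>) (at 0)"
proof -
  let ?a = "\<lambda>i. (deriv ^^ i) wp_reg 0 / fact i"
  have a: "?a (2 * j - 2) = of_nat (2 * j - 1) * eisenstein_G (2 * j) \<tau>" if j: "j \<ge> 2" for j
  proof -
    have "2 * j - 2 \<ge> 1" and e: "2 * j - 2 + 1 = 2 * j - 1" "2 * j - 2 + 2 = 2 * j"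
      using j by auto
    have "fact (2 * j - 1) = (of_nat (2 * j - 1) * fact (2 * j - 2) :: complex)"
      using j fact_reduce[of "2 * j - 1", where 'a = complex] by (simp add: numeral_2_eq_2)
    then show ?thesis
      using wp_reg_higher_deriv_0[OF \<open>2 * j - 2 \<ge> 1\<close>] unfolding e by simp
  qed
  have "(\<Sum>i<2 * k - 2. ?a i * z ^ i) =
      (\<Sum>j=2..<k. of_nat (2 * j - 1) * eisenstein_G (2 * j) \<tau> * z ^ (2 * j - 2))" for z
  proof -
    have "(\<Sum>i<2 * k - 2. ?a i * z ^ i) = (\<Sum>i\<in>(\<lambda>j. 2 * j - 2) ` {2..<k}. ?a i * z ^ i)"
    proof (rule sum.mono_neutral_right)
      show "\<forall>i\<in>{..<2 * k - 2} - (\<lambda>j. 2 * j - 2) ` {2..<k}. ?a i * z ^ i = 0"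
      proof
        fix i assume i: "i \<in> {..<2 * k - 2} - (\<lambda>j. 2 * j - 2) ` {2..<k}"
        have "i = 0 \<or> odd i"
        proof (rule ccontr)
          assume "\<not> ?thesis"
          then obtain l where "i = 2 * l" "l > 0"
            by auto
          then have "i = 2 * (l + 1) - 2" "l + 1 \<in> {2..<k}"
            using i by auto
          then show False
            using i by blast
        qed
        then show "?a i * z ^ i = 0"
          using wp_reg_0 wp_reg_higher_deriv_0_odd by auto
      qed
    qed auto
    also have "\<dots> = (\<Sum>j=2..<k. ?a (2 * j - 2) * z ^ (2 * j - 2))"
      by (subst sum.reindex) (auto simp: inj_on_def)
    also have "\<dots> = (\<Sum>j=2..<k. of_nat (2 * j - 1) * eisenstein_G (2 * j) \<tau> * z ^ (2 * j - 2))"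
      by (intro sum.cong refl) (simp only: a atLeastLessThan_iff)
    finally show ?thesis .
  qed
  then show ?thesis
    using taylor_remainder_limit[OF wp_reg_holomorphic open_regular_set(1), of "2 * k - 2"] a[OF assms] by simp
qed

text \<open>
  Let \<open>F\<close> be the difference of the two sides and \<open>c\<^sub>j = (2j - 1) G\<^sub>2\<^sub>j\<close>. \<open>F\<close> is elliptic, so it suffices that
  \<open>F\<close> tends to \<open>0\<close> at the origin. There the leading terms \<open>z\<^bsup>-2k\<^esup>\<close> of \<open>q k\<close> and \<open>\<wp> q (k - 1)\<close> cancel. The term
  \<open>z\<^bsup>-2\<^esup>\<close> of \<open>\<wp>\<close> times the \<open>z\<^sup>2\<close>-coefficient of \<open>q (k - 1)\<close> contributes \<open>- (k - 1) c\<^sub>k\<close>. The Taylor terms of \<open>\<wp>\<close>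
  times the pole \<open>z\<^bsup>-(2k-2)\<^esup>\<close> of \<open>q (k - 1)\<close> cancel against the poles of the sum up to the contribution \<open>- c\<^sub>k\<close>.
  The constant \<open>k c\<^sub>k\<close> compensates both.
\<close>

lemma wp_centered_relation:
  assumes "k \<ge> 2" "z \<notin> \<Lambda>"
  shows "wp_centered k z = weierstrass_wp \<tau> z * wp_centered (k - 1) z -
    (\<Sum>j=2..<k. of_nat (2 * j - 1) * eisenstein_G (2 * j) \<tau> * wp_centered (k - j) z) -
    of_nat k * (of_nat (2 * k - 1) * eisenstein_G (2 * k) \<tau>)"
proof -
  define c where "c j = of_nat (2 * j - 1) * eisenstein_G (2 * j) \<tau>" for j
  define F where "F = (\<lambda>z. wp_centered k z - weierstrass_wp \<tau> z * wp_centered (k - 1) z +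
    (\<Sum>j=2..<k. c j * wp_centered (k - j) z) + of_nat k * c k)"
  \<comment> \<open>\<open>H\<close> is \<open>F\<close> with the poles cancelled; each of its summands has a limit at the origin\<close>
  define H where "H = (\<lambda>z. wp_centered_reg k z - wp_reg z * wp_centered_reg (k - 1) z +
      (\<Sum>j=2..<k. c j * wp_centered_reg (k - j) z) - wp_centered_reg (k - 1) z / z\<^sup>2 -
      (wp_reg z - (\<Sum>j=2..<k. c j * z ^ (2 * j - 2))) / z ^ (2 * k - 2) + of_nat k * c k)"
  have "F z = H z" if z: "z \<notin> \<Lambda>" for z
  proof -
    have z0: "z \<noteq> 0"
      using z by auto
    have "(\<Sum>j=2..<k. c j * wp_centered (k - j) z) =
        (\<Sum>j=2..<k. c j * z ^ (2 * j - 2) / z ^ (2 * k - 2) + c j * wp_centered_reg (k - j) z)"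
    proof (intro sum.cong refl)
      fix j assume j: "j \<in> {2..<k}"
      have "2 * k - 2 = (2 * j - 2) + 2 * (k - j)"
        using j by auto
      then have frac: "z ^ (2 * j - 2) / z ^ (2 * k - 2) = 1 / z ^ (2 * (k - j))"
        using z0 by (simp add: power_add)
      have "wp_centered (k - j) z = 1 / z ^ (2 * (k - j)) + wp_centered_reg (k - j) z"
        using j z by (intro wp_centered_eq) auto
      then show "c j * wp_centered (k - j) z = c j * z ^ (2 * j - 2) / z ^ (2 * k - 2) + c j * wp_centered_reg (k - j) z"
        unfolding times_divide_eq_right[symmetric] frac by (simp only: distrib_left)
    qed
    also have "\<dots> = (\<Sum>j=2..<k. c j * z ^ (2 * j - 2)) / z ^ (2 * k - 2) + (\<Sum>j=2..<k. c j * wp_centered_reg (k - j) z)"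
      by (simp add: sum.distrib sum_divide_distrib)
    finally have s: "(\<Sum>j=2..<k. c j * wp_centered (k - j) z) = \<dots>" .
    have k: "2 * (k - 1) = 2 * k - 2" "2 * k = 2 + (2 * k - 2)"
      using assms(1) by auto
    have "wp_centered k z = 1 / (z\<^sup>2 * z ^ (2 * k - 2)) + wp_centered_reg k z"
      using wp_centered_eq[OF z, of k] assms(1) k(2) by (metis power_add One_nat_def Suc_1 Suc_leD)
    moreover have "wp_centered (k - 1) z = 1 / z ^ (2 * k - 2) + wp_centered_reg (k - 1) z"
      using wp_centered_eq[OF z, of "k - 1"] assms(1) k(1) by simp
    ultimately show ?thesis
      using z0 unfolding F_def H_def s by (simp add: weierstrass_wp_eq field_simps)
  qed
  then have FH: "eventually (\<lambda>z. H z = F z) (at 0)"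
    using eventually_not_in_lattice[of 0] by (auto elim: eventually_mono)
  have kc: "of_nat (k - 1) * of_nat (2 * (k - 1) + 1) * eisenstein_G (2 * (k - 1) + 2) \<tau> = of_nat (k - 1) * c k"
  proof -
    have "2 * (k - 1) + 1 = 2 * k - 1" "2 * (k - 1) + 2 = 2 * k"
      using assms(1) by auto
    then show ?thesis
      by (simp only: c_def mult.assoc)
  qed
  have wp_reg_lim: "(wp_reg \<longlongrightarrow> 0) (at 0)"
    using taylor_remainder_limit[OF wp_reg_holomorphic open_regular_set(1), of 0] by (simp add: wp_reg_0)
  have "(H \<longlongrightarrow> 0 - 0 * 0 + (\<Sum>j=2..<k. c j * 0) - of_nat (k - 1) * c k - c k + of_nat k * c k) (at 0)"
    unfolding H_def
  proof (intro tendsto_intros)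
    show "((\<lambda>z. wp_centered_reg (k - 1) z / z\<^sup>2) \<longlongrightarrow> of_nat (k - 1) * c k) (at 0)"
      using wp_centered_reg_limits(2)[of "k - 1"] assms(1) unfolding kc by simp
    show "((\<lambda>z. (wp_reg z - (\<Sum>j=2..<k. c j * z ^ (2 * j - 2))) / z ^ (2 * k - 2)) \<longlongrightarrow> c k) (at 0)"
      unfolding c_def by (rule wp_reg_taylor_limit[OF assms(1)])
  qed (use assms(1) wp_reg_lim in \<open>auto intro!: wp_centered_reg_limits(1)\<close>)
  moreover have "0 - 0 * 0 + (\<Sum>j=2..<k. c j * 0) - of_nat (k - 1) * c k - c k + of_nat k * c k = 0"
    using assms(1) by (simp add: of_nat_diff algebra_simps)
  ultimately have "(H \<longlongrightarrow> 0) (at 0)"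
    by simp
  then have F_lim: "(F \<longlongrightarrow> 0) (at 0)"
    using FH by (rule Lim_transform_eventually)
  have "F z = 0"
  proof (rule elliptic_vanishing[OF _ _ _ F_lim assms(2)])
    show "F holomorphic_on - \<Lambda>"
      unfolding F_def by (intro holomorphic_intros wp_centered_holomorphic wp_holomorphic)
    have per: "F (z + \<omega>) = F z" if z: "z \<notin> \<Lambda>" and \<omega>: "\<omega> \<in> {1, \<tau>}" for z \<omega>
    proof -
      have "(\<Sum>j=2..<k. c j * wp_centered (k - j) (z + \<omega>)) = (\<Sum>j=2..<k. c j * wp_centered (k - j) z)"
        using z \<omega> by (intro sum.cong refl arg_cong2[of _ _ _ _ "(*)"] wp_centered_period) auto
      moreover have "weierstrass_wp \<tau> (z + \<omega>) = weierstrass_wp \<tau> z"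
        using z \<omega> wp_plus_1 wp_plus_tau by auto
      ultimately show ?thesis
        using z \<omega> assms(1) unfolding F_def
        by (simp add: wp_centered_period[OF z _ \<omega>])
    qed
    show "F (z + 1) = F z" "F (z + \<tau>) = F z" if "z \<notin> \<Lambda>" for z
      using per[OF that] by auto
  qed
  then show ?thesis
    unfolding F_def c_def by (simp add: algebra_simps)
qed

lemma wp_centered_newton:
  fixes z :: complex
  assumes "z \<notin> \<Lambda>" "k \<ge> 1"
  defines "X \<equiv> \<lambda>j. if j = 1 then weierstrass_wp \<tau> z else - of_nat (2 * j - 1) * eisenstein_G (2 * j) \<tau>"
  shows "wp_centered k z = of_nat k * X k + (\<Sum>j=1..<k. X j * wp_centered (k - j) z)"
proof (cases "k = 1")
  case True
  then show ?thesis
    by (simp add: X_def wp_centered_1[unfolded One_nat_def])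
next
  case False
  with assms(2) have k: "k \<ge> 2" by simp
  have "(\<Sum>j=1..<k. X j * wp_centered (k - j) z) =
      X 1 * wp_centered (k - 1) z + (\<Sum>j=2..<k. X j * wp_centered (k - j) z)"
    using k by (subst sum.atLeast_Suc_lessThan) (auto simp: numeral_2_eq_2)
  also have "(\<Sum>j=2..<k. X j * wp_centered (k - j) z) =
      - (\<Sum>j=2..<k. of_nat (2 * j - 1) * eisenstein_G (2 * j) \<tau> * wp_centered (k - j) z)"
    unfolding sum_negf[symmetric] by (intro sum.cong refl) (simp add: X_def algebra_simps)
  finally have sum_eq: "(\<Sum>j=1..<k. X j * wp_centered (k - j) z) = X 1 * wp_centered (k - 1) z +
      - (\<Sum>j=2..<k. of_nat (2 * j - 1) * eisenstein_G (2 * j) \<tau> * wp_centered (k - j) z)" .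
  have X: "X 1 = weierstrass_wp \<tau> z" "X k = - (of_nat (2 * k - 1) * eisenstein_G (2 * k) \<tau>)"
    using k by (simp_all add: X_def algebra_simps)
  show ?thesis
    unfolding sum_eq X wp_centered_relation[OF k assms(1)] by algebra
qed

end

section \<open>The recursion for the multiple Weierstrass functions\<close>

context half_plane_lattice
begin

text \<open>
  For \<open>k = 1\<close> the series of \<open>1 / (z - w)\<^sup>2\<close> is the sum of the absolutely convergent series of \<open>\<wp>\<close> and the
  conditionally convergent series of \<open>G\<^sub>2\<close>.
\<close>

lemma inverse_power_itlim:
  assumes "z \<notin> \<Lambda>" "k \<ge> 1"
  shows "itlim (\<lambda>M N. \<Sum>w\<in>lattice_box \<tau> M N. 1 / (z - w) ^ (2 * k)) (wp_centered k z + eisenstein_G (2 * k) \<tau>)"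
proof (cases "k = 1")
  case True
  have "itlim (\<lambda>M N. (\<Sum>w\<in>lattice_box \<tau> M N. 1 / (z - w)\<^sup>2 - 1 / w\<^sup>2) + (\<Sum>w\<in>lattice_box \<tau> M N. 1 / w\<^sup>2))
      (weierstrass_wp \<tau> z + eisenstein_G 2 \<tau>)"
    by (intro itlim_add itlim_eisenstein_2 has_sum_lattice_imp_itlim wp_has_sum assms)
  then show ?thesis
    by (simp add: True wp_centered_1[unfolded One_nat_def] sum_subtractf)
next
  case False
  then show ?thesis
    using assms by (intro has_sum_lattice_imp_itlim inverse_power_has_sum) auto
qed

lemma multi_wp_eq_lim_ordered_tuples:
  "multi_wp (replicate j 2) \<tau> z =
    lim (\<lambda>M. lim (\<lambda>N. \<Sum>ws\<in>ordered_tuples (lattice_less \<tau>) (lattice_box \<tau> M N) j. prod_list (map (\<lambda>w. 1 / (z - w)\<^sup>2) ws)))"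
proof -
  have "1 / (\<Prod>i<length (replicate j (2::nat)). (z - ws ! i) ^ (replicate j 2 ! i)) =
      prod_list (map (\<lambda>w. 1 / (z - w)\<^sup>2) ws)" if "length ws = j" for ws
  proof -
    have "(\<Prod>i<length (replicate j (2::nat)). (z - ws ! i) ^ (replicate j 2 ! i)) = (\<Prod>i<j. (z - ws ! i)\<^sup>2)"
      by simp
    moreover have "prod_list (map (\<lambda>w. 1 / (z - w)\<^sup>2) ws) = (\<Prod>i<j. 1 / (z - ws ! i)\<^sup>2)"
      using that by (simp add: prod.list_conv_set_nth atLeast0LessThan)
    ultimately show ?thesis
      by (simp add: prod_dividef)
  qed
  then show ?thesis
    unfolding multi_wp_def increasing_tuples_def ordered_tuples_def
    by (intro arg_cong[where f = lim] ext sum.cong) auto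
qed

lemma multi_wp_2:
  assumes "z \<notin> \<Lambda>"
  shows "multi_wp [2] \<tau> z = weierstrass_wp \<tau> z + eisenstein_G 2 \<tau>"
proof -
  have "ordered_tuples (lattice_less \<tau>) (lattice_box \<tau> M N) 1 = (\<lambda>w. [w]) ` lattice_box \<tau> M N" for M N
    by (auto simp: ordered_tuples_def length_Suc_conv)
  then have "(\<Sum>ws\<in>ordered_tuples (lattice_less \<tau>) (lattice_box \<tau> M N) 1. prod_list (map (\<lambda>w. 1 / (z - w)\<^sup>2) ws)) =
      (\<Sum>w\<in>lattice_box \<tau> M N. 1 / (z - w) ^ (2 * 1))" for M N
    by (simp add: sum.reindex inj_on_def)
  then have "multi_wp (replicate 1 2) \<tau> z = wp_centered 1 z + eisenstein_G (2 * 1) \<tau>"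
    unfolding multi_wp_eq_lim_ordered_tuples using itlim_imp_lim[OF inverse_power_itlim[OF assms order_refl]] by simp
  then show ?thesis
    by (simp add: wp_centered_1[unfolded One_nat_def])
qed

lemma higher_deriv_multi_wp_2:
  assumes "z \<notin> \<Lambda>" "k \<ge> 1"
  shows "(deriv ^^ (2 * k - 2)) (multi_wp [2] \<tau>) z = fact (2 * k - 1) * (wp_centered k z + eisenstein_G (2 * k) \<tau>)"
proof (cases "k = 1")
  case True
  then show ?thesis
    using multi_wp_2[OF assms(1)] by (simp add: wp_centered_1[unfolded One_nat_def])
next
  case False
  have "eventually (\<lambda>z. z \<in> - \<Lambda>) (nhds z)"
    using assms(1) open_regular_set(2) by (intro eventually_nhds_in_open) auto
  then have "eventually (\<lambda>z. multi_wp [2] \<tau> z = weierstrass_wp \<tau> z + eisenstein_G 2 \<tau>) (nhds z)"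
    by eventually_elim (simp add: multi_wp_2)
  then have "(deriv ^^ (2 * k - 2)) (multi_wp [2] \<tau>) z =
      (deriv ^^ (2 * k - 2)) (\<lambda>z. weierstrass_wp \<tau> z + eisenstein_G 2 \<tau>) z"
    by (rule higher_deriv_cong_ev) simp
  also have "\<dots> = (deriv ^^ (2 * k - 2)) (weierstrass_wp \<tau>) z + (deriv ^^ (2 * k - 2)) (\<lambda>z. eisenstein_G 2 \<tau>) z"
    using assms(1) open_regular_set(2) by (intro higher_deriv_add[OF wp_holomorphic]) auto
  finally show ?thesis
    using assms(2) False by (simp add: wp_centered_def constant_term_def)
qed

text \<open>
  The recursion holds for every finite box. It expresses the \<open>k\<close>-th elementary symmetric polynomial
  by earlier ones and power sums, so the iterated limits exist by induction and satisfy the same recursion.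
\<close>

lemma multi_wp_newton:
  fixes z :: complex
  assumes "z \<notin> \<Lambda>"
  defines "P \<equiv> \<lambda>k. wp_centered k z + eisenstein_G (2 * k) \<tau>"
    and "X \<equiv> \<lambda>j. (-1) ^ (j + 1) * multi_wp (replicate j 2) \<tau> z"
  assumes "k \<ge> 1"
  shows "P k = of_nat k * X k + (\<Sum>j=1..<k. X j * P (k - j))"
proof -
  define e where "e j M N = (\<Sum>ws\<in>ordered_tuples (lattice_less \<tau>) (lattice_box \<tau> M N) j.
      prod_list (map (\<lambda>w. 1 / (z - w)\<^sup>2) ws))" for j M N
  define h where "h j M N = (-1) ^ (j + 1) * e j M N" for j M N
  define p where "p k M N = (\<Sum>w\<in>lattice_box \<tau> M N. 1 / (z - w) ^ (2 * k))" for k M N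
  have newton: "p k M N = of_nat k * h k M N + (\<Sum>j=1..<k. h j M N * p (k - j) M N)" if "k \<ge> 1" for k M N
  proof -
    have pw: "(1 / (z - w)\<^sup>2) ^ k = 1 / (z - w) ^ (2 * k)" for w k
      by (simp add: power_one_over power_mult)
    show ?thesis
      using newton_identity_ordered_tuples[OF finite_lattice_box[of M N] lattice_less_order[OF lattice_box_subset] that,
          where x = "\<lambda>w. 1 / (z - w)\<^sup>2"]
      unfolding pw p_def h_def e_def .
  qed
  have p_lim: "itlim (p k) (P k)" if "k \<ge> 1" for k
    using inverse_power_itlim[OF assms(1) that] by (simp add: p_def[abs_def] P_def)
  have "\<exists>L. itlim (h k) L" if "k \<ge> 1" for k
    using that
  proof (induction k rule: less_induct)
    case (less k)
    have "\<forall>j\<in>{1..<k}. \<exists>L. itlim (h j) L"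
      using less.IH by auto
    then obtain L where L: "\<And>j. j \<in> {1..<k} \<Longrightarrow> itlim (h j) (L j)"
      by metis
    have "itlim (\<lambda>M N. 1 / of_nat k * (p k M N - (\<Sum>j=1..<k. h j M N * p (k - j) M N)))
        (1 / of_nat k * (P k - (\<Sum>j=1..<k. L j * P (k - j))))"
      using less.prems by (intro itlim_cmult itlim_diff itlim_sum itlim_mult p_lim L) auto
    moreover have "1 / of_nat k * (p k M N - (\<Sum>j=1..<k. h j M N * p (k - j) M N)) = h k M N" for M N
      using newton[OF less.prems, of M N] less.prems by simp
    ultimately show ?case
      by auto
  qed
  then have h_lim: "itlim (h k) (X k)" if k: "k \<ge> 1" for k
  proof -
    obtain L where L: "itlim (h k) L"
      using \<open>\<And>k. k \<ge> 1 \<Longrightarrow> \<exists>L. itlim (h k) L\<close> k by blast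
    have sq: "(-1) ^ (k + 1) * ((-1) ^ (k + 1) * a) = a" for a :: complex
      by (simp flip: mult.assoc power_add)
    have "itlim (\<lambda>M N. (-1) ^ (k + 1) * h k M N) ((-1) ^ (k + 1) * L)"
      by (rule itlim_cmult[OF L])
    then have "itlim (e k) ((-1) ^ (k + 1) * L)"
      unfolding h_def sq by simp
    from itlim_imp_lim[OF this] have "multi_wp (replicate k 2) \<tau> z = (-1) ^ (k + 1) * L"
      unfolding multi_wp_eq_lim_ordered_tuples e_def .
    then have "X k = L"
      unfolding X_def by (simp only: sq)
    then show ?thesis
      using L by simp
  qed
  have "itlim (p k) (of_nat k * X k + (\<Sum>j=1..<k. X j * P (k - j)))"
  proof -
    have "itlim (\<lambda>M N. of_nat k * h k M N + (\<Sum>j=1..<k. h j M N * p (k - j) M N))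
        (of_nat k * X k + (\<Sum>j=1..<k. X j * P (k - j)))"
      using \<open>k \<ge> 1\<close> by (intro itlim_add itlim_cmult itlim_sum itlim_mult p_lim h_lim) auto
    then show ?thesis
      unfolding newton[OF \<open>k \<ge> 1\<close>, symmetric] .
  qed
  then show ?thesis
    using itlim_imp_lim p_lim[OF \<open>k \<ge> 1\<close>] by metis
qed

end

theorem theorem3p11:
  fixes \<tau> z :: complex and k :: nat
  assumes "Im \<tau> > 0" and "k \<ge> 1" and "z \<notin> period_lattice \<tau>"
  shows "(deriv ^^ (2 * k - 2)) (multi_wp [2] \<tau>) z =
           of_nat k * fact (2 * k - 1) *
             partition_trace k phi_log (\<lambda>j. (-1) ^ (j + 1) * multi_wp (replicate j 2) \<tau> z)
       \<and> (deriv ^^ (2 * k - 2)) (multi_wp [2] \<tau>) z =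
           fact (2 * k - 1) *
             (eisenstein_G (2 * k) \<tau> +
              of_nat k * partition_trace k phi_log
                (\<lambda>j. if j = 1 then weierstrass_wp \<tau> z
                     else - of_nat (2 * j - 1) * eisenstein_G (2 * j) \<tau>))"
proof -
  interpret half_plane_lattice \<tau>
    by unfold_locales (fact assms(1))
  note deriv = higher_deriv_multi_wp_2[OF assms(3,2)]
  have "wp_centered k z + eisenstein_G (2 * k) \<tau> =
      of_nat k * partition_trace k phi_log (\<lambda>j. (-1) ^ (j + 1) * multi_wp (replicate j 2) \<tau> z)"
    using multi_wp_newton[OF assms(3)] assms(2) by (rule newton_recursion_imp_trace)
  moreover have "wp_centered k z = of_nat k * partition_trace k phi_log
      (\<lambda>j. if j = 1 then weierstrass_wp \<tau> z else - of_nat (2 * j - 1) * eisenstein_G (2 * j) \<tau>)"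
    using wp_centered_newton[OF assms(3)] assms(2) by (rule newton_recursion_imp_trace)
  ultimately show ?thesis
    unfolding deriv by (simp only: mult_ac add.commute)
qed

end
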